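(* Let $\nu>-1$. The function $g_\nu(z)=2^{\nu}\Gamma(\nu+1)z^{1-\nu}J_\nu(z)$ is uniformly convex in the open unit disk $U$ if and only if $\nu>\nu_{2}\simeq2.44314\ldots$, where $\nu_{2}$ is the unique root of the equation $$(4\nu-3)J_{\nu+1}(1)-J_{\nu}(1)=0$$ situated in $[0,\infty)$.
   Context: $J_\nu$ is the Bessel function of the first kind of order $\nu$: $J_{\nu}(z)=\sum_{n\ge 0}\frac{(-1)^{n}}{n!\,\Gamma(n+\nu+1)}\left(\frac z2\right)^{2n+\nu}$. The normalized function is $g_\nu(z)=2^{\nu}\Gamma(\nu+1)z^{1-\nu}J_\nu(z)=z-\frac{1}{4(\nu+1)}z^{3}+\frac{1}{32(\nu+1)(\nu+2)}z^5-\dots$ (an entire function). $U=\{z\in\mathbb C:|z|<1\}$. A function $f(z)=z+\sum_{n\ge2}a_nz^n$ is uniformly convex in $U$ if it is analytic in $U$, convex there (univalent with convex image), and for every circular arc $\gamma$ contained in $U$ with center also in $U$, the arc $f(\gamma)$ is convex. Equivalently (Rønning's characterization), $f$ is analytic in $U$ and $\operatorname{Re}\left(1+\frac{zf''(z)}{f'(z)}\right)>\left|\frac{zf''(z)}{f'(z)}\right|$ for all $z\in U$.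
   Formalization: The condition ν>ν₂ is replaced by ν≥ν₂: at ν=ν₂ the equation gives g'(1)+2g''(1)=0, equality only at the boundary point z=1, so g_{ν₂} satisfies the strict inequality in the open disk U and is uniformly convex. *)

theory Defs
  imports "HOL-Complex_Analysis.Complex_Analysis"
begin

(* Principal branch, with the convention w^0 = 1 also at w = 0 (whereas 0 powr 0 = 0),
   so that bessel_J 0 0 = 1. *)
definition cpow :: "complex \<Rightarrow> real \<Rightarrow> complex" where
  "cpow w a = (if a = 0 then 1 else w powr of_real a)"

(* The reciprocal Gamma function rGamma gives the usual meaning, namely 0, to 1 / Gamma at the
   poles of Gamma. *)
definition bessel_J :: "real \<Rightarrow> complex \<Rightarrow> complex" where
  "bessel_J \<nu> z =
     (\<Sum>n. of_real ((-1) ^ n / fact n * rGamma (real n + \<nu> + 1)) * cpow (z / 2) (2 * real n + \<nu>))"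

(* The branches of z^(1-nu) and of J_nu cancel.  At z = 0 the product evaluates to 0, which is the
   value of the entire function z - z^3 / (4 (nu + 1)) + ..., because 0 powr a = 0 for every a and,
   for nu = 1, bessel_J 1 0 = 0. *)
definition bessel_g :: "real \<Rightarrow> complex \<Rightarrow> complex" where
  "bessel_g \<nu> z = of_real (2 powr \<nu> * Gamma (\<nu> + 1)) * cpow z (1 - \<nu>) * bessel_J \<nu> z"

(* Goodman's notion: the arc has a non-vanishing tangent whose argument, chosen continuously, is
   non-decreasing along the arc.  Here rho is the speed and theta the argument of the tangent. *)
definition convex_arc :: "(real \<Rightarrow> complex) \<Rightarrow> bool" where
  "convex_arc \<gamma> \<longleftrightarrow>
     (\<exists>\<theta>. continuous_on {0..1} \<theta> \<and> mono_on {0..1} \<theta> \<and>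
        (\<forall>t\<in>{0..1}. \<exists>\<rho>>0.
           (\<gamma> has_vector_derivative (of_real \<rho> * cis (\<theta> t))) (at t within {0..1})))"

(* Normalized convex univalent functions on the unit disk that map every circular arc in the disk
   whose center also lies in the disk to a convex arc.  As s < t, the circular arcs are traversed
   counterclockwise; the case t = s + 2 pi is a full circle. *)
definition uniformly_convex :: "(complex \<Rightarrow> complex) \<Rightarrow> bool" where
  "uniformly_convex f \<longleftrightarrow>
     f holomorphic_on ball 0 1 \<and> f 0 = 0 \<and> deriv f 0 = 1 \<and>
     inj_on f (ball 0 1) \<and> convex (f ` ball 0 1) \<and>
     (\<forall>\<zeta> r s t. \<zeta> \<in> ball 0 1 \<and> 0 < r \<and> s < t \<and> t \<le> s + 2 * pi \<and>
        path_image (part_circlepath \<zeta> r s t) \<subseteq> ball 0 1 \<longrightarrow>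
        convex_arc (f \<circ> part_circlepath \<zeta> r s t))"

end

(* Write g(z) = z Phi(z^2) and g'(z) = P(z^2). The power series of -P'/P has nonnegative
   coefficients, so on the closed disk |P'/P| is at most its value at 1; if g'(1) + 2 g''(1) >= 0,
   this yields |g''| <= |g'| / 2 on the unit disk. That bound alone implies uniform convexity:
   the tangent argument along an arc centered at zeta has derivative
   Re (1 + (z - zeta) g''/g') >= 1 - 2 * 1/2, and the tangent lines of the images of circles
   |z| = r are supporting lines, which gives the convexity of the image. Conversely, arcs through
   z -> 1 with center -z -> -1 force g'(1) + 2 g''(1) >= 0. Finally g'(1) + 2 g''(1) is a positive
   multiple of (4 nu - 3) J_{nu+1}(1) - J_nu(1) and is strictly increasing in nu, since pairing
   consecutive terms of its alternating series gives monotone summands. *)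
theory Submission
  imports Defs
begin

subsection \<open>Functions with small logarithmic derivative of the derivative\<close>

text \<open>The threshold 1/2 comes from |z - zeta| < 2 for points of the disk. This bound is nearly
  attained only for almost opposite boundary points, so the converse takes antipodal centers.
  Nonnegativity of the coefficients of -P'/P would also follow from partial fractions over the zeros
  of P, once these are known to be positive. Information on zeros is avoided: Bessel's equation
  becomes a Riccati equation whose coefficient recursion has only nonnegative terms. Convergence of
  that series up to the point 1 still requires P to be zero-free slightly beyond the closed unit
  disk. A crude coefficient estimate gives this for nu >= 2, and smaller orders are excluded because
  g'(1) + 2 g''(1) is negative there. The criterion is nonstrict: at the root, g'(1) + 2 g''(1) = 0
  and |g''| <= |g'| / 2 still holds on the disk, so the root itself belongs to the uniformly convex
  orders.\<close>

lemma norm_exp_minus_1_le: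
  fixes a :: complex
  shows "norm (exp a - 1) \<le> exp (norm a) - 1"
proof -
  have "norm (exp (of_real 1 * a) - exp (of_real 0 * a)) \<le> exp (1 * norm a) - exp (0 * norm a)"
  proof (rule differentiable_bound_general[where f = "\<lambda>t. exp (of_real t * a)"
        and \<phi> = "\<lambda>t. exp (t * norm a)" and f' = "\<lambda>t. a * exp (of_real t * a)"
        and \<phi>' = "\<lambda>t. norm a * exp (t * norm a)"])
    show "((\<lambda>t. exp (of_real t * a)) has_vector_derivative a * exp (of_real t * a)) (at t)" for t
      by (rule has_vector_derivative_real_field) (auto intro!: derivative_eq_intros)
    show "((\<lambda>t. exp (t * norm a)) has_vector_derivative norm a * exp (t * norm a)) (at t)" for t
      unfolding has_real_derivative_iff_has_vector_derivative[symmetric]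
      by (auto intro!: derivative_eq_intros)
    show "norm (a * exp (of_real t * a)) \<le> norm a * exp (t * norm a)" if "0 < t" for t
    proof -
      have "t * Re a \<le> t * norm a"
        using that complex_Re_le_cmod by (intro mult_left_mono) auto
      then show ?thesis by (simp add: norm_mult mult_left_mono)
    qed
  qed (auto intro!: continuous_intros)
  then show ?thesis by simp
qed

text \<open>The logarithm \<open>h\<close> of \<open>deriv f\<close> serves twice: a bound on f''/f'
  is a Lipschitz bound for \<open>h\<close>, and \<open>Im (h z)\<close> is a continuous argument of
  f'.\<close>

lemma holomorphic_log_deriv_exists:
  assumes "convex S" "open S" "f holomorphic_on S" "\<And>z. z \<in> S \<Longrightarrow> deriv f z \<noteq> 0" "a \<in> S"
  obtains h where "\<And>z. z \<in> S \<Longrightarrow> deriv f z = exp (h z)"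
    "\<And>z. z \<in> S \<Longrightarrow> (h has_field_derivative deriv (deriv f) z / deriv f z) (at z)"
proof -
  have hol: "deriv f holomorphic_on S"
    using assms by (intro holomorphic_deriv)
  obtain h where h: "h holomorphic_on S" "\<And>z. z \<in> S \<Longrightarrow> exp (h z) = deriv f z"
    using holomorphic_logarithm_exists[OF assms(1,2) hol assms(4,5)] by blast
  have "(h has_field_derivative deriv (deriv f) z / deriv f z) (at z)" if z: "z \<in> S" for z
  proof -
    have dh: "(h has_field_derivative deriv h z) (at z)"
      using h(1) assms(2) z by (rule holomorphic_derivI)
    then have "((\<lambda>z. exp (h z)) has_field_derivative exp (h z) * deriv h z) (at z)"
      by (auto intro!: derivative_eq_intros)
    then have "(deriv f has_field_derivative exp (h z) * deriv h z) (at z)"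
      using has_field_derivative_transform_within_open[OF _ assms(2) z] h(2) by blast
    then have "deriv (deriv f) z = deriv f z * deriv h z"
      using h(2)[OF z] DERIV_imp_deriv by metis
    then show ?thesis using dh assms(4)[OF z] by simp
  qed
  then show ?thesis using that h(2) by metis
qed

text \<open>The logarithm of f' is B-Lipschitz, so |f'(w)/f'(a) - 1| <= exp (B |w - a|) - 1;
  integrating this along the segment from \<open>a\<close> to \<open>b\<close> gives the
  bound.\<close>

lemma norm_diff_linear_approx_le:
  assumes "convex S" "open S" "f holomorphic_on S" "\<And>z. z \<in> S \<Longrightarrow> deriv f z \<noteq> 0"
    and B: "\<And>z. z \<in> S \<Longrightarrow> norm (deriv (deriv f) z) \<le> B * norm (deriv f z)" "B > 0"
    and a: "a \<in> S" and b: "b \<in> S"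
  shows "norm (f b - f a - deriv f a * (b - a))
    \<le> norm (deriv f a) * ((exp (B * norm (b - a)) - 1) / B - norm (b - a))"
proof -
  define d where "d = b - a"
  obtain h where h: "\<And>z. z \<in> S \<Longrightarrow> deriv f z = exp (h z)"
    and dh: "\<And>z. z \<in> S \<Longrightarrow> (h has_field_derivative deriv (deriv f) z / deriv f z) (at z)"
    using holomorphic_log_deriv_exists[OF assms(1-4) a] by blast
  have lip: "norm (h w - h a) \<le> B * norm (w - a)" if "w \<in> S" for w
  proof (rule field_differentiable_bound[OF assms(1) _ _ that a])
    show "(h has_field_derivative deriv (deriv f) z / deriv f z) (at z within S)" if "z \<in> S" for z
      using dh[OF that] by (rule has_field_derivative_at_within)
    show "norm (deriv (deriv f) z / deriv f z) \<le> B" if "z \<in> S" for z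
      using B(1)[OF that] assms(4)[OF that] by (simp add: norm_divide divide_simps)
  qed
  have in_S: "a + of_real t * d \<in> S" if "0 \<le> t" "t \<le> 1" for t
  proof -
    have "(1 - t) *\<^sub>R a + t *\<^sub>R b \<in> S"
      using assms(1) a b that by (intro convexD) auto
    then show ?thesis by (simp add: d_def scaleR_conv_of_real algebra_simps)
  qed
  have dG: "((\<lambda>t. f (a + of_real t * d) - of_real t * (deriv f a * d)) has_vector_derivative
      (deriv f (a + of_real t * d) - deriv f a) * d) (at t within {0..1})" if "0 \<le> t" "t \<le> 1" for t
  proof -
    have "(f has_field_derivative deriv f (a + of_real t * d)) (at (a + of_real t * d))"
      using holomorphic_derivI[OF assms(3,2) in_S[OF that]] .
    moreover have "((\<lambda>t. a + of_real t * d) has_vector_derivative d) (at t within {0..1})"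
      by (auto intro!: derivative_eq_intros)
    ultimately have "((f \<circ> (\<lambda>t. a + of_real t * d)) has_vector_derivative
        d * deriv f (a + of_real t * d)) (at t within {0..1})"
      by (intro field_vector_diff_chain_within) (auto intro: has_field_derivative_at_within)
    moreover have "((\<lambda>t. of_real t * (deriv f a * d)) has_vector_derivative deriv f a * d)
        (at t within {0..1})"
      by (auto intro!: derivative_eq_intros)
    ultimately show ?thesis
      by (auto simp: o_def algebra_simps intro: has_vector_derivative_diff)
  qed
  have "norm ((f (a + of_real 1 * d) - of_real 1 * (deriv f a * d))
            - (f (a + of_real 0 * d) - of_real 0 * (deriv f a * d)))
      \<le> norm (deriv f a) * (exp (B * (1 * norm d)) / B - 1 * norm d)
        - norm (deriv f a) * (exp (B * (0 * norm d)) / B - 0 * norm d)"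
  proof (rule differentiable_bound_general[where
        f = "\<lambda>t. f (a + of_real t * d) - of_real t * (deriv f a * d)"
        and \<phi> = "\<lambda>t. norm (deriv f a) * (exp (B * (t * norm d)) / B - t * norm d)"
        and f' = "\<lambda>t. (deriv f (a + of_real t * d) - deriv f a) * d"
        and \<phi>' = "\<lambda>t. norm (deriv f a) * (exp (B * (t * norm d)) - 1) * norm d"])
    show "continuous_on {0..1} (\<lambda>t. f (a + of_real t * d) - of_real t * (deriv f a * d))"
      using dG by (intro continuous_on_vector_derivative) auto
    show "((\<lambda>t. f (a + of_real t * d) - of_real t * (deriv f a * d)) has_vector_derivative
      (deriv f (a + of_real t * d) - deriv f a) * d) (at t)" if "0 < t" "t < 1" for t
      using dG[of t] at_within_Icc_at[of 0 t 1] that by simp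
    show "((\<lambda>t. norm (deriv f a) * (exp (B * (t * norm d)) / B - t * norm d)) has_vector_derivative
        norm (deriv f a) * (exp (B * (t * norm d)) - 1) * norm d) (at t)" for t
      unfolding has_real_derivative_iff_has_vector_derivative[symmetric] using B(2)
      by (auto intro!: derivative_eq_intros simp: field_simps)
    show "norm ((deriv f (a + of_real t * d) - deriv f a) * d)
        \<le> norm (deriv f a) * (exp (B * (t * norm d)) - 1) * norm d" if "0 < t" "t < 1" for t
    proof -
      let ?w = "a + of_real t * d"
      have w: "?w \<in> S" using in_S that by simp
      have "deriv f ?w - deriv f a = deriv f a * (exp (h ?w - h a) - 1)"
        using h[OF w] h[OF a] by (simp add: exp_diff algebra_simps)
      then have "norm (deriv f ?w - deriv f a) = norm (deriv f a) * norm (exp (h ?w - h a) - 1)"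
        by (simp only: norm_mult)
      also have "\<dots> \<le> norm (deriv f a) * (exp (norm (h ?w - h a)) - 1)"
        by (intro mult_left_mono norm_exp_minus_1_le) auto
      also have "\<dots> \<le> norm (deriv f a) * (exp (B * (t * norm d)) - 1)"
        using lip[OF w] that by (intro mult_left_mono) (auto simp: norm_mult)
      finally show ?thesis by (simp add: norm_mult mult_right_mono)
    qed
  qed (use B(2) in \<open>auto intro!: continuous_intros\<close>)
  then show ?thesis
    by (simp add: d_def algebra_simps diff_divide_distrib)
qed

lemma norm_diff_linear_approx_ball_le:
  assumes "f holomorphic_on ball 0 1" "\<And>z. z \<in> ball 0 1 \<Longrightarrow> deriv f z \<noteq> 0"
    and "\<And>z. z \<in> ball 0 1 \<Longrightarrow> norm (deriv (deriv f) z) \<le> norm (deriv f z) / 2"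
    and "a \<in> ball 0 1" "b \<in> ball 0 1"
  shows "norm (f b - f a - deriv f a * (b - a)) \<le> norm (deriv f a) * (norm (b - a))\<^sup>2 / 2"
proof -
  have d: "norm (b - a) \<le> 2"
    using assms(4,5) norm_triangle_ineq4[of b a] by simp
  have "norm (f b - f a - deriv f a * (b - a))
    \<le> norm (deriv f a) * ((exp (1/2 * norm (b - a)) - 1) / (1/2) - norm (b - a))"
    using assms by (intro norm_diff_linear_approx_le[of "ball 0 1"]) auto
  also have "\<dots> \<le> norm (deriv f a) * ((norm (b - a))\<^sup>2 / 2)"
  proof (rule mult_left_mono)
    \<comment> \<open>The diameter 2 of the disk keeps the exponent in [0, 1], where exp x <= 1 + x
      + x^2.\<close>
    have "exp (norm (b - a) / 2) \<le> 1 + norm (b - a) / 2 + (norm (b - a) / 2)\<^sup>2"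
      using d by (intro exp_bound) auto
    then show "(exp (1/2 * norm (b - a)) - 1) / (1/2) - norm (b - a) \<le> (norm (b - a))\<^sup>2 / 2"
      by (simp add: power2_eq_square)
  qed simp
  finally show ?thesis by simp
qed

section \<open>Univalence and convexity of the image\<close>

lemma inj_on_ball_if_deriv2_le:
  assumes "f holomorphic_on ball 0 1" "\<And>z. z \<in> ball 0 1 \<Longrightarrow> deriv f z \<noteq> 0"
    and "\<And>z. z \<in> ball 0 1 \<Longrightarrow> norm (deriv (deriv f) z) \<le> norm (deriv f z) / 2"
  shows "inj_on f (ball 0 1)"
proof (rule inj_onI, rule ccontr)
  fix a b assume ab: "a \<in> ball 0 1" "b \<in> ball 0 1" "f a = f b" "a \<noteq> b"
  have d: "norm (b - a) < 2"
    using ab norm_triangle_ineq4[of b a] by simp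
  \<comment> \<open>With f a = f b the remainder is the linear term itself, which forces |b - a| >=
    2.\<close>
  have "norm (deriv f a) * norm (b - a) \<le> norm (deriv f a) * (norm (b - a) * (norm (b - a) / 2))"
    using norm_diff_linear_approx_ball_le[OF assms ab(1,2)] ab(3)
    by (simp add: norm_mult power2_eq_square)
  then have "norm (b - a) * 1 \<le> norm (b - a) * (norm (b - a) / 2)"
    using assms(2)[OF ab(1)] by simp
  then have "1 \<le> norm (b - a) / 2"
    using ab(4) by (subst (asm) mult_le_cancel_left_pos) auto
  then show False using d by simp
qed

text \<open>Since i w f'(w) is tangent at f w to the image of the circle through \<open>w\<close>,
  the sign of this real part tells the side of the tangent line. With d = z - w and r = |w|, the
  linear part contributes (|z|^2 - r^2 - |d|^2) / (2 r^2), and its term -|d|^2 / (2 r^2) absorbs the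
  whole remainder.\<close>

lemma supporting_half_plane_if_deriv2_le:
  assumes "f holomorphic_on ball 0 1" "\<And>z. z \<in> ball 0 1 \<Longrightarrow> deriv f z \<noteq> 0"
    and "\<And>z. z \<in> ball 0 1 \<Longrightarrow> norm (deriv (deriv f) z) \<le> norm (deriv f z) / 2"
    and z: "norm z < norm w" "norm w < 1"
  shows "Re ((f z - f w) / (deriv f w * w)) < 0"
proof -
  define r d where "r = norm w" and "d = z - w"
  have r: "0 < r" "r < 1" using z norm_ge_zero[of z] unfolding r_def by linarith+
  have nz: "deriv f w \<noteq> 0" "w \<noteq> 0" using assms(2)[of w] z r by (auto simp: r_def)
  define E where "E = (f z - f w - deriv f w * d) / (deriv f w * w)"
  have "norm (f z - f w - deriv f w * d) \<le> norm (deriv f w) * (norm d)\<^sup>2 / 2"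
    unfolding d_def using z by (intro norm_diff_linear_approx_ball_le assms) auto
  then have "norm E \<le> (norm d)\<^sup>2 / (2 * r)"
    using nz r by (simp add: E_def norm_divide norm_mult r_def field_simps)
  also have "\<dots> \<le> (norm d)\<^sup>2 / (2 * r\<^sup>2)"
    using r by (intro divide_left_mono mult_left_mono mult_pos_pos)
      (auto simp: power2_eq_square)
  finally have E: "norm E \<le> (norm d)\<^sup>2 / (2 * r\<^sup>2)" .
  have "d / w = d * cnj w / of_real (r\<^sup>2)"
    unfolding r_def by (rule complex_div_cnj)
  then have "Re (d / w) = Re (d * cnj w) / r\<^sup>2"
    by (simp only: Re_divide_of_real)
  also have "2 * Re (d * cnj w) = (norm z)\<^sup>2 - r\<^sup>2 - (norm d)\<^sup>2"
    unfolding r_def d_def cmod_power2 by (simp add: power2_eq_square algebra_simps)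
  then have "Re (d * cnj w) = ((norm z)\<^sup>2 - r\<^sup>2 - (norm d)\<^sup>2) / 2" by simp
  also have "\<dots> / r\<^sup>2 = ((norm z)\<^sup>2 - r\<^sup>2) / (2 * r\<^sup>2) - (norm d)\<^sup>2 / (2 * r\<^sup>2)"
    by (simp add: diff_divide_distrib)
  also have "\<dots> < - ((norm d)\<^sup>2 / (2 * r\<^sup>2))"
    using r z by (simp add: r_def divide_less_0_iff power_strict_mono)
  finally have *: "Re (d / w) < - ((norm d)\<^sup>2 / (2 * r\<^sup>2))" .
  have "(f z - f w) / (deriv f w * w) = d / w + E"
    using nz by (simp add: E_def field_simps)
  then have "Re ((f z - f w) / (deriv f w * w)) \<le> Re (d / w) + norm E"
    using complex_Re_le_cmod[of E] by simp
  with * E show ?thesis by linarith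
qed

lemma convex_image_ball_if_deriv2_le:
  assumes "f holomorphic_on ball 0 1" "\<And>z. z \<in> ball 0 1 \<Longrightarrow> deriv f z \<noteq> 0"
    and "\<And>z. z \<in> ball 0 1 \<Longrightarrow> norm (deriv (deriv f) z) \<le> norm (deriv f z) / 2"
  shows "convex (f ` ball 0 1)"
  unfolding convex_contains_segment
proof (intro ballI)
  fix u v assume "u \<in> f ` ball 0 1" "v \<in> f ` ball 0 1"
  then obtain a b where ab: "a \<in> ball 0 1" "b \<in> ball 0 1" "u = f a" "v = f b" by auto
  \<comment> \<open>Since \<open>f\<close> need not extend to the unit circle, the argument runs in
    a smaller disk, whose closure has a compact image.\<close>
  obtain r where r: "max (norm a) (norm b) < r" "r < 1"
    using dense[of "max (norm a) (norm b)" 1] ab by auto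
  define V where "V = f ` ball 0 r"
  have inj: "inj_on f (ball 0 r)"
    using r by (intro inj_on_subset[OF inj_on_ball_if_deriv2_le[OF assms]]) auto
  have holr: "f holomorphic_on ball 0 r" "continuous_on (cball 0 r) f"
    using r by (intro holomorphic_on_subset[OF assms(1)]
        continuous_on_subset[OF holomorphic_on_imp_continuous_on[OF assms(1)]]; force)+
  have "open V"
    unfolding V_def using open_mapping_thm3[OF holr(1) _ inj] by simp
  have "closure V \<subseteq> f ` cball 0 r"
    unfolding V_def using holr(2)
    by (intro closure_minimal compact_imp_closed compact_continuous_image) auto
  then have fr: "frontier V \<subseteq> f ` sphere 0 r"
  proof (intro subsetI)
    fix p assume p: "p \<in> frontier V"
    have "p \<notin> V" using p \<open>open V\<close> by (simp add: frontier_def interior_open)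
    moreover obtain z where "z \<in> cball 0 r" "p = f z"
      using p \<open>closure V \<subseteq> f ` cball 0 r\<close> by (auto simp: frontier_def)
    ultimately have "norm z = r" by (auto simp: V_def image_iff not_less)
    then show "p \<in> f ` sphere 0 r" using \<open>p = f z\<close> by simp
  qed
  \<comment> \<open>A segment leaving V meets the frontier at some f w with |w| = r. Both endpoints
    lie strictly on one side of the tangent line there, so f w cannot be a convex combination of
    them.\<close>
  have "closed_segment u v \<subseteq> V"
  proof (rule ccontr)
    assume "\<not> ?thesis"
    moreover have "u \<in> V" "v \<in> V" using ab r by (auto simp: V_def)
    ultimately have "closed_segment u v \<inter> frontier V \<noteq> {}"
      by (intro connected_Int_frontier) auto
    then obtain p where p: "p \<in> closed_segment u v" "p \<in> frontier V" by blast
    then obtain w where "w \<in> sphere 0 r" "p = f w" using fr by blast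
    then have w: "norm w = r" "f w \<in> closed_segment u v" using p by auto
    define L where "L = (\<lambda>p. Re ((p - f w) / (deriv f w * w)))"
    have L: "L u < 0" "L v < 0"
      unfolding L_def ab using r w by (auto intro!: supporting_half_plane_if_deriv2_le assms)
    obtain l where l: "0 \<le> l" "l \<le> 1" "f w = (1 - l) *\<^sub>R u + l *\<^sub>R v"
      using w(2) by (auto simp: in_segment)
    have "(1 - l) *\<^sub>R (u - f w) + l *\<^sub>R (v - f w) = 0"
      unfolding l(3) by (simp add: algebra_simps)
    then have "Re (((1 - l) *\<^sub>R (u - f w) + l *\<^sub>R (v - f w)) / (deriv f w * w)) = 0" by simp
    then have "(1 - l) * L u + l * L v = 0"
      by (simp add: L_def add_divide_distrib scaleR_conv_of_real mult.assoc
          flip: times_divide_eq_right)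
    moreover have "(1 - l) * L u \<le> 0" "l * L v \<le> 0"
      using l L by (auto intro: mult_nonneg_nonpos)
    ultimately have "(1 - l) * L u = 0" "l * L v = 0" by linarith+
    then show False using L by auto
  qed
  also have "V \<subseteq> f ` ball 0 1" using r by (auto simp: V_def)
  finally show "closed_segment u v \<subseteq> f ` ball 0 1" .
qed

section \<open>Images of circular arcs\<close>

lemma part_circlepath_minus_center:
  "part_circlepath \<zeta> r s t x - \<zeta> = of_real r * exp (\<i> * of_real (linepath s t x))"
  by (simp add: part_circlepath_def)

lemma convex_arc_if_deriv2_le:
  assumes "f holomorphic_on ball 0 1" "\<And>z. z \<in> ball 0 1 \<Longrightarrow> deriv f z \<noteq> 0"
    and "\<And>z. z \<in> ball 0 1 \<Longrightarrow> norm (deriv (deriv f) z) \<le> norm (deriv f z) / 2"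
    and \<zeta>: "\<zeta> \<in> ball 0 1" and "0 < r" "s < t"
    and im: "path_image (part_circlepath \<zeta> r s t) \<subseteq> ball 0 1"
  shows "convex_arc (f \<circ> part_circlepath \<zeta> r s t)"
proof -
  define \<gamma> where "\<gamma> = part_circlepath \<zeta> r s t"
  obtain h where h: "\<And>z. z \<in> ball 0 1 \<Longrightarrow> deriv f z = exp (h z)"
    and dh: "\<And>z. z \<in> ball 0 1 \<Longrightarrow> (h has_field_derivative deriv (deriv f) z / deriv f z) (at z)"
    using holomorphic_log_deriv_exists[of "ball 0 1" f 0] assms by auto
  have \<gamma>: "\<gamma> x \<in> ball 0 1" if "x \<in> {0..1}" for x
    using im that unfolding \<gamma>_def path_image_def by blast
  have d\<gamma>: "(\<gamma> has_vector_derivative \<i> * of_real (t - s) * (\<gamma> x - \<zeta>)) (at x within X)" for x X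
    unfolding \<gamma>_def
    by (rule has_vector_derivative_eq_rhs[OF has_vector_derivative_part_circlepath])
      (simp add: part_circlepath_minus_center)
  \<comment> \<open>The tangent of the image is i (t - s) (gamma - zeta) f'(gamma); the three
    summands are the arguments of f'(gamma), of i, and of gamma - zeta.\<close>
  define \<theta> where "\<theta> = (\<lambda>x. Im (h (\<gamma> x)) + pi / 2 + linepath s t x)"
  define \<theta>' where
    "\<theta>' = (\<lambda>x. (t - s) * (1 + Re ((\<gamma> x - \<zeta>) * (deriv (deriv f) (\<gamma> x) / deriv f (\<gamma> x)))))"
  have d\<theta>: "(\<theta> has_real_derivative \<theta>' x) (at x)" if x: "x \<in> {0..1}" for x
  proof -
    have "((h \<circ> \<gamma>) has_vector_derivative
        \<i> * of_real (t - s) * (\<gamma> x - \<zeta>) * (deriv (deriv f) (\<gamma> x) / deriv f (\<gamma> x))) (at x)"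
      using d\<gamma> dh[OF \<gamma>[OF x]] by (intro field_vector_diff_chain_at) auto
    then have "((\<lambda>x. Im ((h \<circ> \<gamma>) x)) has_vector_derivative
        Im (\<i> * of_real (t - s) * (\<gamma> x - \<zeta>) * (deriv (deriv f) (\<gamma> x) / deriv f (\<gamma> x)))) (at x)"
      by (rule bounded_linear.has_vector_derivative[OF bounded_linear_Im])
    also have "Im (\<i> * of_real (t - s) * (\<gamma> x - \<zeta>) * (deriv (deriv f) (\<gamma> x) / deriv f (\<gamma> x)))
        = (t - s) * Re ((\<gamma> x - \<zeta>) * (deriv (deriv f) (\<gamma> x) / deriv f (\<gamma> x)))"
      by (simp add: mult.assoc del: times_divide_eq_right)
    finally have "((\<lambda>x. Im (h (\<gamma> x))) has_real_derivative
        (t - s) * Re ((\<gamma> x - \<zeta>) * (deriv (deriv f) (\<gamma> x) / deriv f (\<gamma> x)))) (at x)"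
      by (simp add: has_real_derivative_iff_has_vector_derivative o_def)
    moreover have "(linepath s t has_real_derivative t - s) (at x)"
      unfolding linepath_def by (auto intro!: derivative_eq_intros)
    ultimately show ?thesis
      unfolding \<theta>_def \<theta>'_def
      by (auto intro!: DERIV_add[THEN DERIV_cong] DERIV_const simp: distrib_left)
  qed
  have \<theta>'_nonneg: "\<theta>' x \<ge> 0" if x: "x \<in> {0..1}" for x
  proof -
    let ?q = "deriv (deriv f) (\<gamma> x) / deriv f (\<gamma> x)"
    have "norm (\<gamma> x - \<zeta>) \<le> 2"
      using \<gamma>[OF x] \<zeta> norm_triangle_ineq4[of "\<gamma> x" \<zeta>] by simp
    moreover have "norm ?q \<le> 1 / 2"
      using assms(2,3)[OF \<gamma>[OF x]] by (simp add: norm_divide divide_simps)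
    ultimately have "norm ((\<gamma> x - \<zeta>) * ?q) \<le> 2 * (1 / 2)"
      unfolding norm_mult by (intro mult_mono) auto
    then have "-1 \<le> Re ((\<gamma> x - \<zeta>) * ?q)"
      using abs_Re_le_cmod[of "(\<gamma> x - \<zeta>) * ?q"] by linarith
    then show ?thesis using \<open>s < t\<close> by (simp add: \<theta>'_def)
  qed
  show ?thesis
    unfolding convex_arc_def \<gamma>_def[symmetric]
  proof (intro exI[of _ \<theta>] conjI ballI)
    show "continuous_on {0..1} \<theta>"
      using d\<theta> DERIV_isCont by (intro continuous_at_imp_continuous_on) blast
    show "mono_on {0..1} \<theta>"
    proof (rule mono_onI)
      fix x y :: real assume xy: "x \<in> {0..1}" "y \<in> {0..1}" "x \<le> y"
      show "\<theta> x \<le> \<theta> y"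
      proof (rule DERIV_nonneg_imp_nondecreasing[OF xy(3)])
        fix u assume "x \<le> u" "u \<le> y"
        then have "u \<in> {0..1}" using xy by simp
        then show "\<exists>D. (\<theta> has_real_derivative D) (at u) \<and> 0 \<le> D"
          using d\<theta> \<theta>'_nonneg by blast
      qed
    qed
  next
    fix x :: real assume x: "x \<in> {0..1}"
    let ?\<rho> = "norm (deriv f (\<gamma> x)) * r * (t - s)"
    have "(f has_field_derivative deriv f (\<gamma> x)) (at (\<gamma> x))"
      using \<gamma>[OF x] assms(1) by (intro holomorphic_derivI[of _ "ball 0 1"]) auto
    then have "((f \<circ> \<gamma>) has_vector_derivative
        \<i> * of_real (t - s) * (\<gamma> x - \<zeta>) * deriv f (\<gamma> x)) (at x within {0..1})"
      using d\<gamma> by (intro field_vector_diff_chain_within) (auto intro: has_field_derivative_at_within)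
    also have "\<i> * of_real (t - s) * (\<gamma> x - \<zeta>) * deriv f (\<gamma> x) = of_real ?\<rho> * cis (\<theta> x)"
    proof -
      have "deriv f (\<gamma> x) = of_real (norm (deriv f (\<gamma> x))) * cis (Im (h (\<gamma> x)))"
        using h[OF \<gamma>[OF x]] by (metis exp_eq_polar norm_exp_eq_Re)
      moreover have "\<gamma> x - \<zeta> = of_real r * cis (linepath s t x)"
        by (simp add: \<gamma>_def part_circlepath_minus_center cis_conv_exp)
      moreover have "\<i> = cis (pi / 2)" by simp
      ultimately have "\<i> * of_real (t - s) * (\<gamma> x - \<zeta>) * deriv f (\<gamma> x) =
         of_real ?\<rho> * (cis (Im (h (\<gamma> x))) * cis (pi / 2) * cis (linepath s t x))"
        by (simp add: mult_ac)
      then show ?thesis by (simp only: \<theta>_def cis_mult)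
    qed
    finally have "((f \<circ> \<gamma>) has_vector_derivative of_real ?\<rho> * cis (\<theta> x)) (at x within {0..1})" .
    moreover have "?\<rho> > 0" using assms(2)[OF \<gamma>[OF x]] \<open>0 < r\<close> \<open>s < t\<close> by simp
    ultimately show "\<exists>\<rho>>0. ((f \<circ> \<gamma>) has_vector_derivative of_real \<rho> * cis (\<theta> x)) (at x within {0..1})"
      by blast
  qed
qed

lemma uniformly_convex_if_deriv2_le:
  assumes "f holomorphic_on ball 0 1" "f 0 = 0" "deriv f 0 = 1"
    and "\<And>z. z \<in> ball 0 1 \<Longrightarrow> deriv f z \<noteq> 0"
    and "\<And>z. z \<in> ball 0 1 \<Longrightarrow> norm (deriv (deriv f) z) \<le> norm (deriv f z) / 2"
  shows "uniformly_convex f"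
  unfolding uniformly_convex_def
  using assms inj_on_ball_if_deriv2_le convex_image_ball_if_deriv2_le convex_arc_if_deriv2_le by auto

subsection \<open>Convexity of images of arcs as a differential inequality\<close>

lemma uniformly_convex_deriv_nonzero:
  assumes "uniformly_convex f" "z \<in> ball 0 1"
  shows "deriv f z \<noteq> 0"
  using assms holomorphic_injective_imp_regular[of f "ball 0 1" z]
  by (auto simp: uniformly_convex_def)

text \<open>The angle \<open>\<theta>\<close> is only known to be continuous and monotone, so its
  derivative is replaced by that of Im (gamma'(x) / gamma'(0)). This is a positive multiple of sin
  (theta x - theta 0), which vanishes at 0 and is nonnegative while the angle difference stays in
  [0, pi].\<close>

lemma convex_arc_tangent_Im_nonneg:
  assumes arc: "convex_arc \<gamma>" and d\<gamma>: "\<And>x. x \<in> {0..1} \<Longrightarrow> (\<gamma> has_vector_derivative \<gamma>' x) (at x within {0..1})"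
    and d\<gamma>': "(\<gamma>' has_vector_derivative w) (at 0 within {0..1})"
  shows "Im (w / \<gamma>' 0) \<ge> 0"
proof -
  obtain \<theta> where \<theta>: "continuous_on {0..1} \<theta>" "mono_on {0..1} \<theta>"
    "\<And>x. x \<in> {0..1} \<Longrightarrow> \<exists>\<rho>>0. (\<gamma> has_vector_derivative (of_real \<rho> * cis (\<theta> x))) (at x within {0..1})"
    using arc unfolding convex_arc_def by blast
  have ex: "\<exists>\<rho>>0. \<gamma>' x = of_real \<rho> * cis (\<theta> x)" if x: "x \<in> {0..1}" for x
  proof -
    obtain \<rho> where "\<rho> > 0"
      "(\<gamma> has_vector_derivative (of_real \<rho> * cis (\<theta> x))) (at x within cbox 0 1)"
      using \<theta>(3)[OF x] by auto
    moreover have "(\<gamma> has_vector_derivative \<gamma>' x) (at x within cbox 0 1)"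
      using d\<gamma>[OF x] by simp
    ultimately show ?thesis
      using vector_derivative_unique_within_closed_interval[of 0 1 x \<gamma>] x by fastforce
  qed
  obtain \<rho>0 where \<rho>0: "\<rho>0 > 0" "\<gamma>' 0 = of_real \<rho>0 * cis (\<theta> 0)" using ex[of 0] by auto
  define q where "q = (\<lambda>x. Im (\<gamma>' x / \<gamma>' 0))"
  have "((\<lambda>x. \<gamma>' x * (1 / \<gamma>' 0)) has_vector_derivative w * (1 / \<gamma>' 0)) (at 0 within {0..1})"
    using d\<gamma>' by (rule has_vector_derivative_mult_left)
  then have "(q has_vector_derivative Im (w / \<gamma>' 0)) (at 0 within {0..1})"
    unfolding q_def
    using bounded_linear.has_vector_derivative[OF bounded_linear_Im, of "\<lambda>x. \<gamma>' x / \<gamma>' 0"] by simp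
  then have "(q has_real_derivative Im (w / \<gamma>' 0)) (at 0 within {0..1})"
    by (simp add: has_real_derivative_iff_has_vector_derivative)
  then have lim: "((\<lambda>x. (q x - q 0) / (x - 0)) \<longlongrightarrow> Im (w / \<gamma>' 0)) (at 0 within {0..1})"
    by (simp add: has_field_derivative_iff)
  have "(\<theta> \<longlongrightarrow> \<theta> 0) (at 0 within {0..1})"
    using \<theta>(1) by (auto simp: continuous_on)
  then have "\<forall>\<^sub>F x in at 0 within {0..1}. \<theta> x < \<theta> 0 + pi"
    by (rule order_tendstoD) simp
  moreover have "\<forall>\<^sub>F x in at (0::real) within {0..1}. x \<in> {0..1} \<and> x \<noteq> 0"
    by (simp add: eventually_at_filter)
  ultimately have ev: "\<forall>\<^sub>F x in at 0 within {0..1}. 0 \<le> (q x - q 0) / (x - 0)"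
  proof eventually_elim
    case (elim x)
    obtain \<rho> where \<rho>: "\<rho> > 0" "\<gamma>' x = of_real \<rho> * cis (\<theta> x)" using ex elim by blast
    have "\<theta> 0 \<le> \<theta> x" using \<theta>(2) elim by (auto simp: mono_on_def)
    then have "0 \<le> sin (\<theta> x - \<theta> 0)" using elim by (intro sin_ge_zero) auto
    moreover have "\<gamma>' x / \<gamma>' 0 = of_real (\<rho> / \<rho>0) * cis (\<theta> x - \<theta> 0)"
      using \<rho> \<rho>0 by (simp add: cis_divide[symmetric])
    then have "q x = \<rho> / \<rho>0 * sin (\<theta> x - \<theta> 0)"
      by (simp add: q_def)
    moreover have "q 0 = 0" using \<rho>0 by (simp add: q_def)
    ultimately show ?case using elim \<rho> \<rho>0 by simp
  qed
  have "at (0::real) within {0..1} \<noteq> bot"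
    by (simp add: at_within_Icc_at_right)
  then show ?thesis using tendsto_lowerbound[OF lim ev] by blast
qed

lemma uniformly_convex_imp_Re_nonneg:
  assumes uc: "uniformly_convex f" and z: "z \<in> ball 0 1" and \<zeta>: "\<zeta> \<in> ball 0 1" and "z \<noteq> \<zeta>"
  shows "Re (1 + (z - \<zeta>) * (deriv (deriv f) z / deriv f z)) \<ge> 0"
proof -
  define r s where "r = norm (z - \<zeta>)" and "s = Arg (z - \<zeta>)"
  \<comment> \<open>The opening angle of a short arc starting at \<open>z\<close>: its points are
    within r c <= (1 - |z|) / 2 of \<open>z\<close>, so the arc stays in the disk; 2 pi is the
    largest angle that the definition admits.\<close>
  define c where "c = min (2 * pi) ((1 - norm z) / (2 * r))"
  have r: "r > 0" using \<open>z \<noteq> \<zeta>\<close> by (simp add: r_def)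
  have c: "0 < c" "c \<le> 2 * pi" "r * c < 1 - norm z"
  proof -
    show "0 < c" "c \<le> 2 * pi" using z r by (auto simp: c_def)
    have "r * c \<le> r * ((1 - norm z) / (2 * r))"
      using r by (intro mult_left_mono) (auto simp: c_def)
    also have "\<dots> < 1 - norm z" using r z by simp
    finally show "r * c < 1 - norm z" .
  qed
  define \<gamma> where "\<gamma> = part_circlepath \<zeta> r s (s + c)"
  have \<gamma>_eq: "\<gamma> x = \<zeta> + (z - \<zeta>) * exp (\<i> * of_real (c * x))" for x
  proof -
    have "z - \<zeta> = of_real r * exp (\<i> * of_real s)"
      using Arg_eq[of "z - \<zeta>"] \<open>z \<noteq> \<zeta>\<close> by (simp add: r_def s_def)
    moreover have "linepath s (s + c) x = s + c * x"
      by (simp add: linepath_def algebra_simps)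
    ultimately show ?thesis
      by (simp add: \<gamma>_def part_circlepath_def exp_add distrib_left)
  qed
  have \<gamma>_in: "\<gamma> x \<in> ball 0 1" if x: "x \<in> {0..1}" for x
  proof -
    have "norm (exp (\<i> * of_real (c * x)) - 1) \<le> \<bar>c * x\<bar>"
      using dist_exp_i_1[of "c * x"] abs_sin_x_le_abs_x[of "c * x / 2"] by simp
    also have "\<dots> \<le> c" using x c by (simp add: abs_mult mult_left_le)
    finally have "norm ((z - \<zeta>) * (exp (\<i> * of_real (c * x)) - 1)) \<le> r * c"
      using r by (simp add: norm_mult r_def)
    moreover have "\<gamma> x = z + (z - \<zeta>) * (exp (\<i> * of_real (c * x)) - 1)"
      by (simp add: \<gamma>_eq algebra_simps)
    ultimately have "norm (\<gamma> x) \<le> norm z + r * c"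
      by (metis norm_triangle_le add_left_mono)
    then show ?thesis using c by simp
  qed
  have arc: "convex_arc (f \<circ> \<gamma>)"
  proof -
    have "path_image \<gamma> \<subseteq> ball 0 1" using \<gamma>_in by (auto simp: path_image_def)
    then show ?thesis
      using uc r c \<zeta> unfolding uniformly_convex_def \<gamma>_def by (simp del: o_apply)
  qed
  have d\<gamma>: "(\<gamma> has_vector_derivative \<i> * of_real c * (\<gamma> x - \<zeta>)) (at x within X)" for x X
    unfolding \<gamma>_def
    by (rule has_vector_derivative_eq_rhs[OF has_vector_derivative_part_circlepath])
      (simp add: part_circlepath_def)
  have hol: "f holomorphic_on ball 0 1" using uc by (simp add: uniformly_convex_def)
  have df: "(f has_field_derivative deriv f w) (at w)"
    "(deriv f has_field_derivative deriv (deriv f) w) (at w)" if "w \<in> ball 0 1" for w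
    using that hol by (auto intro!: holomorphic_derivI holomorphic_deriv)
  define D where "D = (\<lambda>x. \<i> * of_real c * (\<gamma> x - \<zeta>) * deriv f (\<gamma> x))"
  have "((f \<circ> \<gamma>) has_vector_derivative D x) (at x within {0..1})" if x: "x \<in> {0..1}" for x
    unfolding D_def
    using d\<gamma> df(1)[OF \<gamma>_in[OF x]]
    by (intro field_vector_diff_chain_within) (auto intro: has_field_derivative_at_within)
  moreover have "(D has_vector_derivative
      \<i> * of_real c * (\<i> * of_real c * (\<gamma> 0 - \<zeta>)) * deriv f (\<gamma> 0) +
      \<i> * of_real c * (\<gamma> 0 - \<zeta>) * (\<i> * of_real c * (\<gamma> 0 - \<zeta>) * deriv (deriv f) (\<gamma> 0)))
    (at 0 within {0..1})"
  proof -
    have "((deriv f \<circ> \<gamma>) has_vector_derivative \<i> * of_real c * (\<gamma> 0 - \<zeta>) * deriv (deriv f) (\<gamma> 0))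
        (at 0 within {0..1})"
      using d\<gamma> df(2)[OF \<gamma>_in[of 0]]
      by (intro field_vector_diff_chain_within) (auto intro: has_field_derivative_at_within)
    moreover have "((\<lambda>x. \<i> * of_real c * (\<gamma> x - \<zeta>)) has_vector_derivative
        \<i> * of_real c * (\<i> * of_real c * (\<gamma> 0 - \<zeta>))) (at 0 within {0..1})"
      using has_vector_derivative_mult_right[OF has_vector_derivative_diff[OF d\<gamma> has_vector_derivative_const]]
      by fastforce
    ultimately show ?thesis
      unfolding D_def using has_vector_derivative_mult by (fastforce simp: o_def add.commute)
  qed
  ultimately have "0 \<le> Im ((\<i> * of_real c * (\<i> * of_real c * (\<gamma> 0 - \<zeta>)) * deriv f (\<gamma> 0) +
      \<i> * of_real c * (\<gamma> 0 - \<zeta>) * (\<i> * of_real c * (\<gamma> 0 - \<zeta>) * deriv (deriv f) (\<gamma> 0))) / D 0)"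
    using convex_arc_tangent_Im_nonneg[OF arc] by blast
  also have "\<gamma> 0 = z" by (simp add: \<gamma>_eq)
  then have "(\<i> * of_real c * (\<i> * of_real c * (\<gamma> 0 - \<zeta>)) * deriv f (\<gamma> 0) +
      \<i> * of_real c * (\<gamma> 0 - \<zeta>) * (\<i> * of_real c * (\<gamma> 0 - \<zeta>) * deriv (deriv f) (\<gamma> 0))) / D 0
    = \<i> * of_real c * (1 + (z - \<zeta>) * (deriv (deriv f) z / deriv f z))"
    using uniformly_convex_deriv_nonzero[OF uc z] \<open>z \<noteq> \<zeta>\<close> c(1)
    by (simp add: D_def field_simps)
  also have "Im \<dots> = c * Re (1 + (z - \<zeta>) * (deriv (deriv f) z / deriv f z))"
    by (simp add: mult.assoc del: times_divide_eq_right)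
  finally show ?thesis using c(1) by (simp add: zero_le_mult_iff del: times_divide_eq_right)
qed

subsection \<open>The Bessel power series\<close>

text \<open>The coefficients of the hypergeometric series 0F1(; nu + 1; -x/4), that is, of Phi with
  g(z) = z Phi(z^2); the Gamma factor is split off so that Phi(0) = 1.\<close>

definition bessel_coeff :: "real \<Rightarrow> nat \<Rightarrow> real" where
  "bessel_coeff \<nu> n = (-1/4) ^ n / (fact n * pochhammer (\<nu> + 1) n)"

lemma bessel_coeff_0 [simp]: "bessel_coeff \<nu> 0 = 1"
  by (simp add: bessel_coeff_def)

lemma bessel_coeff_nonzero: "\<nu> > -1 \<Longrightarrow> bessel_coeff \<nu> n \<noteq> 0"
  using pochhammer_pos[of "\<nu> + 1" n] by (simp add: bessel_coeff_def)

lemma bessel_coeff_Suc: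
  assumes "\<nu> > -1"
  shows "bessel_coeff \<nu> (Suc n) = - bessel_coeff \<nu> n / (4 * (real n + 1) * (\<nu> + 1 + real n))"
proof -
  have "(-1/4) * A / (k * f * (q * p)) = - (A / (f * p)) / (4 * k * q)" for A k f q p :: real
    by (simp add: mult_ac)
  from this[of "(-1/4) ^ n" "real n + 1" "fact n" "\<nu> + 1 + real n" "pochhammer (\<nu> + 1) n"]
  show ?thesis
    by (simp add: bessel_coeff_def pochhammer_rec' add_ac)
qed

text \<open>Coefficient form of Phi_nu' = - Phi_(nu+1) / (4 (nu + 1)), which later brings in
  J_(nu+1).\<close>

lemma bessel_coeff_shift:
  assumes "\<nu> > -1"
  shows "(real n + 1) * bessel_coeff \<nu> (Suc n) = - bessel_coeff (\<nu> + 1) n / (4 * (\<nu> + 1))"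
proof -
  have "k * ((-1/4) * A / (k * f * (q * p))) = - (A / (f * p)) / (4 * q)" if "k \<noteq> 0" for A k f q p :: real
    using that by (simp add: mult_ac)
  from this[of "real n + 1" "(-1/4) ^ n" "fact n" "\<nu> + 1" "pochhammer (\<nu> + 2) n"]
  show ?thesis
    by (simp add: bessel_coeff_def pochhammer_rec add_ac)
qed

definition bessel_fps :: "real \<Rightarrow> complex fps" where
  "bessel_fps \<nu> = Abs_fps (\<lambda>n. of_real (bessel_coeff \<nu> n))"

lemma fps_nth_bessel_fps [simp]: "fps_nth (bessel_fps \<nu>) n = of_real (bessel_coeff \<nu> n)"
  by (simp add: bessel_fps_def)

lemma fps_conv_radius_bessel_fps [simp]:
  assumes "\<nu> > -1"
  shows "fps_conv_radius (bessel_fps \<nu>) = \<infinity>"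
  unfolding fps_conv_radius_def
proof (rule conv_radius_ratio_limit_ereal)
  show "\<forall>\<^sub>F n in sequentially. fps_nth (bessel_fps \<nu>) n \<noteq> 0"
    using bessel_coeff_nonzero[OF assms] by simp
  have ratio: "norm (fps_nth (bessel_fps \<nu>) n) / norm (fps_nth (bessel_fps \<nu>) (Suc n))
      = 4 * (real n + 1) * (\<nu> + 1 + real n)" for n
  proof -
    have "norm (fps_nth (bessel_fps \<nu>) n) = \<bar>- bessel_coeff \<nu> n\<bar>" by simp
    also have "\<dots> = 4 * (real n + 1) * (\<nu> + 1 + real n) * \<bar>bessel_coeff \<nu> (Suc n)\<bar>"
      unfolding bessel_coeff_Suc[OF assms] using assms by (simp add: abs_mult)
    finally show ?thesis using bessel_coeff_nonzero[OF assms, of "Suc n"] by simp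
  qed
  have "filterlim (\<lambda>n. 4 * (real n + 1) * (\<nu> + 1 + real n)) at_top sequentially"
  proof (rule filterlim_at_top_mono[OF filterlim_real_sequentially], intro always_eventually allI)
    fix n
    have "real n * 1 \<le> (\<nu> + 1 + real n) * (4 * (real n + 1))"
      using assms by (intro mult_mono) auto
    then show "real n \<le> 4 * (real n + 1) * (\<nu> + 1 + real n)" by (simp add: mult_ac)
  qed
  then show "(\<lambda>n. ereal (norm (fps_nth (bessel_fps \<nu>) n) / norm (fps_nth (bessel_fps \<nu>) (Suc n))))
      \<longlonglongrightarrow> \<infinity>"
    unfolding ratio by (simp add: tendsto_PInfty_eq_at_top)
qed

lemma fps_conv_radius_deriv_infinity [simp]:
  fixes F :: "complex fps"
  shows "fps_conv_radius F = \<infinity> \<Longrightarrow> fps_conv_radius (fps_deriv F) = \<infinity>"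
  using fps_conv_radius_deriv[of F] by simp

lemma bessel_J_eq:
  assumes "\<nu> > -1" "z \<noteq> 0"
  shows "bessel_J \<nu> z =
    (z / 2) powr of_real \<nu> * of_real (rGamma (\<nu> + 1)) * eval_fps (bessel_fps \<nu>) (z\<^sup>2)"
proof -
  have "of_real ((-1) ^ n / fact n * rGamma (real n + \<nu> + 1)) * cpow (z / 2) (2 * real n + \<nu>)
      = (z / 2) powr of_real \<nu> * of_real (rGamma (\<nu> + 1))
        * (fps_nth (bessel_fps \<nu>) n * (z\<^sup>2) ^ n)" for n
  proof -
    have "rGamma (\<nu> + 1) = pochhammer (\<nu> + 1) n * rGamma (real n + \<nu> + 1)"
      using pochhammer_rGamma[of "\<nu> + 1" n] by (simp add: add_ac)
    moreover have "(-1/4 :: real) ^ n * 4 ^ n = (-1) ^ n"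
      by (simp flip: power_mult_distrib)
    ultimately have c: "(-1) ^ n / fact n * rGamma (real n + \<nu> + 1)
        = rGamma (\<nu> + 1) * bessel_coeff \<nu> n * 4 ^ n"
      using pochhammer_pos[of "\<nu> + 1" n] assms by (simp add: bessel_coeff_def mult_ac)
    have "cpow (z / 2) a = (z / 2) powr of_real a" for a
      using assms by (simp add: cpow_def)
    then have "cpow (z / 2) (2 * real n + \<nu>) = (z / 2) powr (of_real \<nu> + of_nat (2 * n))"
      by (simp only: of_real_add of_real_mult of_real_of_nat_eq of_nat_mult of_real_numeral
          of_nat_numeral add.commute)
    also have "\<dots> = (z / 2) powr of_real \<nu> * (z / 2) ^ (2 * n)"
      using assms powr_nat'[of "z / 2" "2 * n"] by (simp only: powr_add) auto
    also have "(z / 2) ^ (2 * n) = (z\<^sup>2) ^ n / 4 ^ n"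
      by (simp add: power_mult power_divide)
    finally have p: "cpow (z / 2) (2 * real n + \<nu>) = (z / 2) powr of_real \<nu> * ((z\<^sup>2) ^ n / 4 ^ n)" .
    show ?thesis unfolding p c by simp
  qed
  moreover have "summable (\<lambda>n. fps_nth (bessel_fps \<nu>) n * (z\<^sup>2) ^ n)"
    using assms by (intro summable_fps) simp
  ultimately show ?thesis
    unfolding bessel_J_def eval_fps_def by (simp only: suminf_mult)
qed

lemma bessel_g_eq:
  assumes "\<nu> > -1"
  shows "bessel_g \<nu> z = z * eval_fps (bessel_fps \<nu>) (z\<^sup>2)"
proof (cases "z = 0")
  case True
  have "cpow 0 (2 * real n + 1) = 0" for n
    by (simp add: cpow_def)
  then show ?thesis using True
    by (cases "\<nu> = 1") (simp_all add: bessel_g_def cpow_def bessel_J_def)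
next
  case False
  have "cpow z (1 - \<nu>) = z powr (1 - of_real \<nu>)"
    using False by (simp add: cpow_def)
  also have "\<dots> = z / z powr of_real \<nu>"
    using False by (simp add: powr_diff)
  finally have 1: "cpow z (1 - \<nu>) = z / z powr of_real \<nu>" .
  \<comment> \<open>Division by a positive real does not change the branch, so the powers of z
    cancel exactly.\<close>
  have "Ln (z / of_real 2) = Ln z - of_real (ln 2)"
    using False by (intro Ln_divide_of_real) auto
  then have "of_real \<nu> * Ln (z / 2) = of_real \<nu> * Ln z - of_real (\<nu> * ln 2)"
    by (simp only: of_real_numeral right_diff_distrib of_real_mult)
  moreover have "of_real (2 powr \<nu>) = exp (of_real (\<nu> * ln 2) :: complex)"
    by (simp add: powr_def flip: exp_of_real)
  ultimately have 2: "(z / 2) powr of_real \<nu> = z powr of_real \<nu> / of_real (2 powr \<nu>)"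
    using False by (simp only: powr_def exp_diff) simp
  have 3: "Gamma (\<nu> + 1) * rGamma (\<nu> + 1) = 1"
    using assms Gamma_real_pos[of "\<nu> + 1"] by (simp add: rGamma_inverse_Gamma less_imp_neq[symmetric])
  have "bessel_g \<nu> z = of_real (Gamma (\<nu> + 1) * rGamma (\<nu> + 1)) * z * eval_fps (bessel_fps \<nu>) (z\<^sup>2)"
    unfolding bessel_g_def bessel_J_eq[OF assms False] 1 2 using False by simp
  then show ?thesis by (simp add: 3)
qed

text \<open>\<open>bessel_g'_fps \<nu>\<close> is the derivative of \<open>bessel_g \<nu>\<close> as a series in the square of the variable.\<close>

definition bessel_g'_fps :: "real \<Rightarrow> complex fps" where
  "bessel_g'_fps \<nu> = bessel_fps \<nu> + fps_const 2 * (fps_X * fps_deriv (bessel_fps \<nu>))"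

lemma fps_nth_bessel_g'_fps:
  "fps_nth (bessel_g'_fps \<nu>) n = of_real ((2 * real n + 1) * bessel_coeff \<nu> n)"
  by (cases n) (simp_all add: bessel_g'_fps_def algebra_simps)

lemma fps_conv_radius_add_infinity [simp]:
  fixes F G :: "complex fps"
  shows "fps_conv_radius F = \<infinity> \<Longrightarrow> fps_conv_radius G = \<infinity> \<Longrightarrow> fps_conv_radius (F + G) = \<infinity>"
  using fps_conv_radius_add[of F G] by simp

lemma fps_conv_radius_mult_infinity [simp]:
  fixes F G :: "complex fps"
  shows "fps_conv_radius F = \<infinity> \<Longrightarrow> fps_conv_radius G = \<infinity> \<Longrightarrow> fps_conv_radius (F * G) = \<infinity>"
  using fps_conv_radius_mult[of F G] by simp

lemma fps_conv_radius_bessel_g'_fps [simp]: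
  "\<nu> > -1 \<Longrightarrow> fps_conv_radius (bessel_g'_fps \<nu>) = \<infinity>"
  by (simp add: bessel_g'_fps_def)

lemma eval_fps_bessel_g'_fps:
  assumes "\<nu> > -1"
  shows "eval_fps (bessel_g'_fps \<nu>) w =
    eval_fps (bessel_fps \<nu>) w + 2 * w * eval_fps (fps_deriv (bessel_fps \<nu>)) w"
  using assms by (simp add: bessel_g'_fps_def eval_fps_add eval_fps_mult)

lemma has_field_derivative_eval_fps_square:
  fixes F :: "complex fps"
  assumes "fps_conv_radius F = \<infinity>"
  shows "((\<lambda>z. eval_fps F (z\<^sup>2)) has_field_derivative 2 * z * eval_fps (fps_deriv F) (z\<^sup>2)) (at z)"
proof -
  have "(eval_fps F has_field_derivative eval_fps (fps_deriv F) (z\<^sup>2)) (at (z\<^sup>2))"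
    using assms by (intro has_field_derivative_eval_fps) simp
  moreover have "((\<lambda>z. z\<^sup>2) has_field_derivative 2 * z) (at z)"
    by (auto intro!: derivative_eq_intros)
  ultimately show ?thesis
    using DERIV_chain2 by (fastforce simp: mult.commute)
qed

lemma has_field_derivative_bessel_g:
  assumes "\<nu> > -1"
  shows "(bessel_g \<nu> has_field_derivative eval_fps (bessel_g'_fps \<nu>) (z\<^sup>2)) (at z)"
proof -
  have "((\<lambda>z. z * eval_fps (bessel_fps \<nu>) (z\<^sup>2)) has_field_derivative
      eval_fps (bessel_g'_fps \<nu>) (z\<^sup>2)) (at z)"
    by (rule DERIV_cong[OF DERIV_mult[OF DERIV_ident has_field_derivative_eval_fps_square]])
      (use assms in \<open>simp_all add: eval_fps_bessel_g'_fps power2_eq_square\<close>)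
  then show ?thesis using bessel_g_eq[OF assms] by presburger
qed

lemma deriv_bessel_g:
  assumes "\<nu> > -1"
  shows "deriv (bessel_g \<nu>) = (\<lambda>z. eval_fps (bessel_g'_fps \<nu>) (z\<^sup>2))"
  using has_field_derivative_bessel_g[OF assms] by (auto intro: DERIV_imp_deriv)

lemma deriv_deriv_bessel_g:
  assumes "\<nu> > -1"
  shows "deriv (deriv (bessel_g \<nu>)) = (\<lambda>z. 2 * z * eval_fps (fps_deriv (bessel_g'_fps \<nu>)) (z\<^sup>2))"
  unfolding deriv_bessel_g[OF assms]
  using has_field_derivative_eval_fps_square[of "bessel_g'_fps \<nu>"] assms
  by (auto intro: DERIV_imp_deriv)

section \<open>Bessel's equation and nonnegative coefficients\<close>

text \<open>This is Bessel's equation in the variable x = z^2. It yields the Riccati equation, and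
  at x = 1 it eliminates Phi''.\<close>

lemma bessel_fps_ode:
  assumes "\<nu> > -1"
  shows "fps_const 4 * (fps_X * fps_deriv (fps_deriv (bessel_fps \<nu>)))
    + fps_const (of_real (4 * (\<nu> + 1))) * fps_deriv (bessel_fps \<nu>) + bessel_fps \<nu> = 0"
proof (rule fps_ext)
  fix n
  have "4 * (real n + 1) * (\<nu> + 1 + real n) * bessel_coeff \<nu> (Suc n) = - bessel_coeff \<nu> n"
    unfolding bessel_coeff_Suc[OF assms] using assms by simp
  then have "of_real (4 * (real n + 1) * (\<nu> + 1 + real n) * bessel_coeff \<nu> (Suc n))
      = (of_real (- bessel_coeff \<nu> n) :: complex)"
    by (simp only:)
  then show "fps_nth (fps_const 4 * (fps_X * fps_deriv (fps_deriv (bessel_fps \<nu>)))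
    + fps_const (of_real (4 * (\<nu> + 1))) * fps_deriv (bessel_fps \<nu>) + bessel_fps \<nu>) n = fps_nth 0 n"
    by (cases n) (simp_all add: algebra_simps)
qed

text \<open>Comparing coefficients, (n + nu + 1) u_n is 1/4 for n = 0 and otherwise a sum of
  products of earlier coefficients. In the order on \<open>complex\<close>, being nonnegative
  includes being real.\<close>

lemma nonneg_coeffs_riccati:
  fixes U :: "complex fps"
  assumes "\<nu> > -1"
    and "fps_X * fps_deriv U + fps_const (of_real (\<nu> + 1)) * U = fps_const (1/4) + fps_X * U\<^sup>2"
  shows "fps_nth U n \<ge> 0"
proof (induction n rule: less_induct)
  case (less n)
  have "fps_nth (fps_X * fps_deriv U + fps_const (of_real (\<nu> + 1)) * U) n
      = of_real (real n + \<nu> + 1) * fps_nth U n"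
    by (cases n) (simp_all add: algebra_simps)
  moreover have "fps_nth (fps_const (1/4) + fps_X * U\<^sup>2) n \<ge> 0"
  proof (cases n)
    case 0
    then show ?thesis by (simp add: less_eq_complex_def)
  next
    case (Suc m)
    have "fps_nth (U\<^sup>2) m \<ge> 0"
      using less Suc by (auto simp: power2_eq_square fps_mult_nth intro!: sum_nonneg mult_nonneg_nonneg)
    then show ?thesis using Suc by simp
  qed
  ultimately have "0 \<le> of_real (real n + \<nu> + 1) * fps_nth U n"
    using assms(2) by metis
  then show ?case
    using assms(1) by (auto simp: less_eq_complex_def zero_le_mult_iff)
qed

text \<open>The inverse satisfies V = 1 + S V; as S has no constant term, each coefficient of V is
  built from earlier ones.\<close>

lemma nonneg_coeffs_inverse_one_minus:
  fixes S :: "complex fps"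
  assumes "\<And>n. fps_nth S n \<ge> 0" "fps_nth S 0 = 0"
  shows "fps_nth (inverse (1 - S)) n \<ge> 0"
proof (induction n rule: less_induct)
  case (less n)
  let ?V = "inverse (1 - S)"
  have "?V * (1 - S) = 1"
    using assms(2) by (intro inverse_mult_eq_1) simp
  then have "?V = 1 + S * ?V"
    by (simp add: algebra_simps)
  then have "fps_nth ?V n = fps_nth 1 n + (\<Sum>i=0..n. fps_nth S i * fps_nth ?V (n - i))"
    by (metis fps_add_nth fps_mult_nth)
  moreover have "fps_nth S i * fps_nth ?V (n - i) \<ge> 0" if "i \<in> {0..n}" for i
  proof (cases "i = 0")
    case True
    then show ?thesis using assms(2) by simp
  next
    case False
    then show ?thesis using less[of "n - i"] assms(1)[of i] that by simp
  qed
  moreover have "fps_nth (1 :: complex fps) n \<ge> 0" by (simp add: less_eq_complex_def)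
  ultimately show ?case
    by (metis (no_types, lifting) add_nonneg_nonneg sum_nonneg)
qed

text \<open>With \<open>U = - \<Phi>' / \<Phi>\<close> and \<open>S = 2 X U\<close>, the series is \<open>P = \<Phi> (1 - S)\<close>, hence
  \<open>- P' / P = U + S' / (1 - S)\<close>; the Bessel equation becomes a Riccati equation for \<open>U\<close>.\<close>

lemma nonneg_coeffs_log_deriv_bessel_g':
  assumes "\<nu> > -1"
  shows "fps_nth (- fps_deriv (bessel_g'_fps \<nu>) * inverse (bessel_g'_fps \<nu>)) n \<ge> 0"
proof -
  let ?\<Phi> = "bessel_fps \<nu>" and ?P = "bessel_g'_fps \<nu>"
  define U where "U = - fps_deriv ?\<Phi> * inverse ?\<Phi>"
  have inv: "inverse ?\<Phi> * ?\<Phi> = 1"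
    by (intro inverse_mult_eq_1) simp
  then have d\<Phi>: "fps_deriv ?\<Phi> = - U * ?\<Phi>"
    by (simp add: U_def mult.assoc)
  have nz: "?\<Phi> \<noteq> 0" using inv by auto
  have dd\<Phi>: "fps_deriv (fps_deriv ?\<Phi>) = (U\<^sup>2 - fps_deriv U) * ?\<Phi>"
    unfolding d\<Phi> by (simp add: d\<Phi> algebra_simps power2_eq_square)
  have c4: "fps_const 4 * fps_const (1/4) = (1 :: complex fps)" by (simp flip: fps_const_mult)
  \<comment> \<open>Both derivatives of Phi are multiples of Phi, which can be cancelled in the
    integral domain of power series.\<close>
  have "?\<Phi> * (fps_const 4 * (fps_X * (U\<^sup>2 - fps_deriv U)) - fps_const (of_real (4 * (\<nu> + 1))) * U + 1) = 0"
    using bessel_fps_ode[OF assms] unfolding dd\<Phi> unfolding d\<Phi> by (simp add: algebra_simps)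
  then have "fps_const 4 * (fps_X * (U\<^sup>2 - fps_deriv U)) - fps_const (of_real (4 * (\<nu> + 1))) * U + 1 = 0"
    using nz by simp
  moreover have "fps_const (of_real (4 * (\<nu> + 1))) = fps_const 4 * (fps_const (of_real (\<nu> + 1)) :: complex fps)"
    by simp
  ultimately have "fps_const 4 * (fps_X * fps_deriv U + fps_const (of_real (\<nu> + 1)) * U)
      = fps_const 4 * (fps_const (1/4) + fps_X * U\<^sup>2)"
    unfolding distrib_left c4 by (simp add: algebra_simps del: fps_const_mult)
  then have "fps_X * fps_deriv U + fps_const (of_real (\<nu> + 1)) * U = fps_const (1/4) + fps_X * U\<^sup>2"
    by (simp only: mult_cancel_left) simp
  then have U: "fps_nth U n \<ge> 0" for n
    using nonneg_coeffs_riccati[OF assms] by blast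
  define S where "S = fps_const 2 * (fps_X * U)"
  have S: "fps_nth S n \<ge> 0" "fps_nth S 0 = 0" for n
    using U[of "n - 1"] by (simp_all add: S_def less_eq_complex_def)
  define V where "V = inverse (1 - S)"
  have V: "V * (1 - S) = 1"
    unfolding V_def using S(2) by (intro inverse_mult_eq_1) simp
  have P: "?P = ?\<Phi> * (1 - S)"
    by (simp add: bessel_g'_fps_def d\<Phi> S_def algebra_simps)
  have P0: "inverse ?P * ?P = 1"
    by (intro inverse_mult_eq_1) (simp add: fps_nth_bessel_g'_fps)
  have "- fps_deriv ?P = (U + fps_deriv S * V) * ?P"
  proof -
    have "(U + fps_deriv S * V) * ?P = U * ?P + fps_deriv S * (V * (1 - S)) * ?\<Phi>"
      unfolding P by (simp add: algebra_simps)
    also have "\<dots> = - fps_deriv ?P"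
      unfolding V unfolding P by (simp add: d\<Phi> algebra_simps)
    finally show ?thesis ..
  qed
  then have "- fps_deriv ?P * inverse ?P = (U + fps_deriv S * V) * (inverse ?P * ?P)"
    by (simp add: mult_ac)
  then have "- fps_deriv ?P * inverse ?P = U + fps_deriv S * V"
    by (simp add: P0)
  moreover have "fps_nth (fps_deriv S) n \<ge> 0" for n
    using S(1) by (simp add: less_eq_complex_def)
  moreover have "fps_nth V n \<ge> 0" for n
    unfolding V_def using S by (rule nonneg_coeffs_inverse_one_minus)
  ultimately show ?thesis
    using U by (simp add: fps_mult_nth sum_nonneg)
qed

section \<open>A zero-free disk and the bound for the logarithmic derivative\<close>

lemma pow_le_pochhammer:
  fixes x :: real
  assumes "0 \<le> a" "a \<le> x"
  shows "a ^ n \<le> pochhammer x n"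
proof (induction n)
  case (Suc n)
  have "a ^ Suc n = a * a ^ n" by simp
  also have "\<dots> \<le> (x + of_nat n) * pochhammer x n"
    using assms Suc by (intro mult_mono) auto
  also have "\<dots> = pochhammer x (Suc n)"
    by (simp add: pochhammer_rec')
  finally show ?case .
qed simp

lemma norm_bessel_g'_fps_nth_le:
  assumes "\<nu> \<ge> 2"
  shows "norm (fps_nth (bessel_g'_fps \<nu>) n) \<le> 3 / 12 ^ n"
proof -
  have p: "3 ^ n \<le> pochhammer (\<nu> + 1) n"
    using assms by (intro pow_le_pochhammer) auto
  have f: "2 * real n + 1 \<le> 3 * fact n"
  proof (induction n)
    case (Suc n)
    have "(1::real) \<le> fact n" by (rule fact_ge_1)
    then have "real n * 1 \<le> real n * fact n" by (intro mult_left_mono) auto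
    then have "1 \<le> real n * fact n \<or> n = 0" by (cases "n = 0") linarith+
    then show ?case using Suc by (auto simp: algebra_simps)
  qed simp
  have "norm (fps_nth (bessel_g'_fps \<nu>) n) = (2 * real n + 1) / (4 ^ n * fact n * pochhammer (\<nu> + 1) n)"
    using assms pochhammer_pos[of "\<nu> + 1" n]
    by (simp add: fps_nth_bessel_g'_fps bessel_coeff_def norm_mult norm_divide norm_power power_divide abs_mult
        del: of_real_mult of_real_divide of_real_power)
  also have "\<dots> \<le> (3 * fact n) / (4 ^ n * fact n * 3 ^ n)"
    using p f by (intro frac_le mult_left_mono) auto
  also have "\<dots> = 3 / (4 ^ n * 3 ^ n)"
    by simp
  also have "\<dots> = 3 / 12 ^ n"
    by (simp flip: power_mult_distrib)
  finally show ?thesis .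
qed

text \<open>The tail is dominated by the sum of 3 (2/12)^n over n >= 1, which is 3/5 < 1. The radius
  2 is a convenient choice beyond 1.\<close>

lemma norm_bessel_g'_minus_1_le:
  assumes "\<nu> \<ge> 2" "norm w < 2"
  shows "norm (eval_fps (bessel_g'_fps \<nu>) w - 1) \<le> 3 / 5"
proof -
  let ?c = "fps_nth (bessel_g'_fps \<nu>)"
  have "summable (\<lambda>n. ?c n * w ^ n)"
    using assms by (intro summable_fps) simp
  then have "(\<lambda>n. ?c n * w ^ n) sums eval_fps (bessel_g'_fps \<nu>) w"
    unfolding eval_fps_def by (rule summable_sums)
  then have s: "(\<lambda>n. ?c (Suc n) * w ^ Suc n) sums (eval_fps (bessel_g'_fps \<nu>) w - 1)"
    using sums_Suc_iff[of "\<lambda>n. ?c n * w ^ n"] by (simp add: fps_nth_bessel_g'_fps)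
  have "(\<lambda>n. 1/2 * (1/6) ^ n) sums (1/2 * (1 / (1 - 1/6 :: real)))"
    by (intro sums_mult geometric_sums) simp
  then have g: "(\<lambda>n. 1/2 * (1/6) ^ n) sums (3/5 :: real)" by simp
  have bound: "norm (?c (Suc n) * w ^ Suc n) \<le> 1/2 * (1/6) ^ n" for n
  proof -
    have "norm (?c (Suc n) * w ^ Suc n) \<le> 3 / 12 ^ Suc n * 2 ^ Suc n"
      unfolding norm_mult norm_power using assms
      by (intro mult_mono norm_bessel_g'_fps_nth_le power_mono) auto
    also have "\<dots> = 3 * (2 / 12) ^ Suc n" by (simp only: power_divide) simp
    also have "\<dots> = 1/2 * (1/6) ^ n" by simp
    finally show ?thesis .
  qed
  have "norm (\<Sum>n. ?c (Suc n) * w ^ Suc n) \<le> (\<Sum>n. 1/2 * (1/6) ^ n)"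
    using bound sums_summable[OF g] by (intro norm_suminf_le) auto
  then show ?thesis using sums_unique[OF s] sums_unique[OF g] by simp
qed

lemma bessel_g'_nonzero:
  assumes "\<nu> \<ge> 2" "norm w < 2"
  shows "eval_fps (bessel_g'_fps \<nu>) w \<noteq> 0"
  using norm_bessel_g'_minus_1_le[OF assms] by auto

lemma norm_log_deriv_bessel_g'_le:
  assumes "\<nu> \<ge> 2" "norm w \<le> 1"
  shows "norm (eval_fps (fps_deriv (bessel_g'_fps \<nu>)) w / eval_fps (bessel_g'_fps \<nu>) w)
    \<le> - Re (eval_fps (fps_deriv (bessel_g'_fps \<nu>)) 1 / eval_fps (bessel_g'_fps \<nu>) 1)"
proof -
  let ?P = "bessel_g'_fps \<nu>"
  define H where "H = (\<lambda>w. - eval_fps (fps_deriv ?P) w * inverse (eval_fps ?P w))"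
  define N where "N = - fps_deriv ?P * inverse ?P"
  have R: "fps_conv_radius ?P = \<infinity>" using assms by simp
  have exp: "H has_fps_expansion N"
    unfolding H_def N_def using R
    by (intro has_fps_expansion_mult has_fps_expansion_minus has_fps_expansion_inverse
        eval_fps_has_fps_expansion) (simp_all add: fps_nth_bessel_g'_fps)
  \<comment> \<open>Holomorphy beyond the unit circle makes the Taylor series converge on the closed
    disk, in particular at 1.\<close>
  have hol: "H holomorphic_on eball 0 (ereal 2)"
    unfolding H_def using R bessel_g'_nonzero[OF assms(1)]
    by (intro holomorphic_intros) auto
  have sums: "(\<lambda>n. fps_nth N n * w ^ n) sums H w" if "norm w \<le> 1" for w
    using has_fps_expansion_imp_sums_complex[OF exp hol] that by auto
  have N: "fps_nth N n \<ge> 0" for n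
    unfolding N_def using assms by (intro nonneg_coeffs_log_deriv_bessel_g') simp
  then have normN: "norm (fps_nth N n) = Re (fps_nth N n)" for n
    using N[of n] by (simp add: less_eq_complex_def cmod_def)
  have s1: "(\<lambda>n. Re (fps_nth N n)) sums Re (H 1)"
    using sums_Re[OF sums[of 1]] by simp
  have "norm (\<Sum>n. fps_nth N n * w ^ n) \<le> (\<Sum>n. Re (fps_nth N n))"
  proof (rule norm_suminf_le)
    show "norm (fps_nth N n * w ^ n) \<le> Re (fps_nth N n)" for n
      using assms(2) by (simp add: norm_mult norm_power normN[symmetric] mult_left_le power_le_one)
    show "summable (\<lambda>n. Re (fps_nth N n))" using s1 by (rule sums_summable)
  qed
  then have "norm (H w) \<le> Re (H 1)"
    using sums_unique[OF s1] sums_unique[OF sums[OF assms(2)]] by simp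
  then show ?thesis
    by (simp add: H_def norm_mult divide_inverse)
qed

subsection \<open>The critical series\<close>

text \<open>Absolute values of the terms: 2n + 1 arises from differentiating z^(2n+1), and 4n + 1 =
  1 + 2 (2n) from adding twice the second derivative at 1.\<close>

definition crit_coeff :: "real \<Rightarrow> nat \<Rightarrow> real" where
  "crit_coeff \<nu> n = (2 * real n + 1) * (4 * real n + 1) / (4 ^ n * fact n * pochhammer (\<nu> + 1) n)"

text \<open>\<open>crit \<nu> = g'(1) + 2 g''(1)\<close> for \<open>g = bessel_g \<nu>\<close>, expanded as an alternating series.\<close>

definition crit :: "real \<Rightarrow> real" where
  "crit \<nu> = (\<Sum>n. (-1) ^ n * crit_coeff \<nu> n)"

text \<open>The part of the quotient of consecutive \<open>crit_coeff\<close> that does not depend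
  on the order.\<close>

definition crit_ratio :: "nat \<Rightarrow> real" where
  "crit_ratio n = (2 * real n + 3) * (4 * real n + 5) / ((2 * real n + 1) * (4 * real n + 1) * (4 * (real n + 1)))"

lemma crit_coeff_0 [simp]: "crit_coeff \<nu> 0 = 1"
  by (simp add: crit_coeff_def)

lemma crit_coeff_Suc: "crit_coeff \<nu> (Suc n) = crit_coeff \<nu> n * crit_ratio n / (\<nu> + 1 + real n)"
proof -
  have "a * b / (4 * q * (k * f) * (x * p)) = c * d / (q * f * p) * (a * b / (c * d * (4 * k))) / x"
    if "c \<noteq> 0" "d \<noteq> 0" for a b c d q f p k x :: real
    using that by (simp add: mult_ac)
  from this[of "2 * real n + 1" "4 * real n + 1" "2 * real n + 3" "4 * real n + 5" "4 ^ n"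
      "real n + 1" "fact n" "\<nu> + 1 + real n" "pochhammer (\<nu> + 1) n"]
  have "(2 * real n + 3) * (4 * real n + 5)
      / (4 * 4 ^ n * ((real n + 1) * fact n) * ((\<nu> + 1 + real n) * pochhammer (\<nu> + 1) n))
    = crit_coeff \<nu> n * crit_ratio n / (\<nu> + 1 + real n)"
    unfolding crit_coeff_def crit_ratio_def by (auto simp: add_pos_nonneg less_imp_neq[symmetric])
  moreover have "2 * real (Suc n) + 1 = 2 * real n + 3" "4 * real (Suc n) + 1 = 4 * real n + 5"
    "(fact (Suc n) :: real) = (real n + 1) * fact n"
    by (simp_all add: algebra_simps)
  ultimately show ?thesis
    by (simp only: crit_coeff_def pochhammer_rec' power_Suc)
qed

text \<open>The restriction matters: \<open>crit_ratio 0\<close> is 15/4.\<close>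

lemma crit_ratio_le_1: "n \<ge> 1 \<Longrightarrow> crit_ratio n \<le> 1"
proof -
  assume "n \<ge> 1"
  then have n: "real n \<ge> 1" by simp
  have "(2 * real n + 3) * (4 * real n + 5) \<le> (2 * real n + 1) * (4 * real n + 1) * 8"
    using mult_mono[OF n n] n by (simp add: algebra_simps)
  also have "\<dots> \<le> (2 * real n + 1) * (4 * real n + 1) * (4 * (real n + 1))"
    using n by (intro mult_left_mono) auto
  finally show ?thesis by (simp add: crit_ratio_def)
qed

lemma crit_ratio_nonneg: "crit_ratio n \<ge> 0"
  by (simp add: crit_ratio_def)

lemma crit_coeff_pos: "\<nu> > -1 \<Longrightarrow> crit_coeff \<nu> n > 0"
  by (auto simp: crit_coeff_def intro!: divide_pos_pos mult_pos_pos pochhammer_pos)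

lemma pochhammer_mono_real:
  fixes a b :: real
  assumes "0 < a" "a \<le> b"
  shows "pochhammer a n \<le> pochhammer b n"
  unfolding pochhammer_prod using assms by (intro prod_mono) auto

lemma crit_coeff_antimono:
  assumes "-1 < a" "a \<le> b"
  shows "crit_coeff b n \<le> crit_coeff a n"
  unfolding crit_coeff_def using assms
  by (intro divide_left_mono mult_left_mono pochhammer_mono_real mult_pos_pos pochhammer_pos) auto

text \<open>Each summand of the last factor is antitone in \<open>\<nu>\<close> because \<open>0 < crit_ratio (n + 1) \<le> 1\<close>.\<close>

lemma crit_coeff_diff_eq:
  assumes "\<nu> > -1"
  shows "crit_coeff \<nu> (Suc n) - crit_coeff \<nu> (Suc (Suc n)) = crit_coeff \<nu> n * crit_ratio n
    * ((1 - crit_ratio (Suc n)) / (\<nu> + 1 + real n) + crit_ratio (Suc n) / (\<nu> + 2 + real n))"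
proof -
  have "t / x - t / x * r / (x + 1) = t * ((1 - r) / x + r / (x + 1))" if "x > 0" for t x r :: real
    using that by (simp add: divide_simps) (simp add: algebra_simps)
  from this[of "\<nu> + 1 + real n" "crit_coeff \<nu> n * crit_ratio n" "crit_ratio (Suc n)"] assms
  show ?thesis by (simp add: crit_coeff_Suc add_ac)
qed

lemma crit_ratio_pos: "crit_ratio n > 0"
  by (auto simp: crit_ratio_def intro!: divide_pos_pos mult_pos_pos)

lemma crit_coeff_diff_pos:
  assumes "\<nu> > -1"
  shows "crit_coeff \<nu> (Suc n) - crit_coeff \<nu> (Suc (Suc n)) > 0"
proof -
  have "0 \<le> (1 - crit_ratio (Suc n)) / (\<nu> + 1 + real n)"
    using assms crit_ratio_le_1[of "Suc n"] by simp
  moreover have "0 < crit_ratio (Suc n) / (\<nu> + 2 + real n)"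
    using assms crit_ratio_pos by simp
  ultimately show ?thesis
    unfolding crit_coeff_diff_eq[OF assms]
    using crit_coeff_pos[OF assms, of n] crit_ratio_pos[of n] by simp
qed

lemma crit_coeff_diff_strict_antimono:
  assumes "-1 < a" "a < b"
  shows "crit_coeff b (Suc n) - crit_coeff b (Suc (Suc n)) < crit_coeff a (Suc n) - crit_coeff a (Suc (Suc n))"
proof -
  have "b > -1" using assms by simp
  note pos = crit_ratio_pos[of "Suc n"] crit_ratio_le_1[of "Suc n"]
  show ?thesis
    unfolding crit_coeff_diff_eq[OF assms(1)] crit_coeff_diff_eq[OF \<open>b > -1\<close>]
  proof (rule mult_le_less_imp_less)
    show "crit_coeff b n * crit_ratio n \<le> crit_coeff a n * crit_ratio n"
      using assms crit_ratio_nonneg by (intro mult_right_mono crit_coeff_antimono) auto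
    have "(1 - crit_ratio (Suc n)) / (b + 1 + real n) \<le> (1 - crit_ratio (Suc n)) / (a + 1 + real n)"
      using assms pos by (intro divide_left_mono mult_pos_pos) auto
    moreover have "crit_ratio (Suc n) / (b + 2 + real n) < crit_ratio (Suc n) / (a + 2 + real n)"
      using assms pos by (intro divide_strict_left_mono mult_pos_pos) auto
    ultimately show "(1 - crit_ratio (Suc n)) / (b + 1 + real n) + crit_ratio (Suc n) / (b + 2 + real n)
      < (1 - crit_ratio (Suc n)) / (a + 1 + real n) + crit_ratio (Suc n) / (a + 2 + real n)"
      by (rule add_le_less_mono)
    show "0 < crit_coeff b n * crit_ratio n"
      using crit_coeff_pos[OF \<open>b > -1\<close>] crit_ratio_pos by simp
    show "0 \<le> (1 - crit_ratio (Suc n)) / (b + 1 + real n) + crit_ratio (Suc n) / (b + 2 + real n)"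
      using \<open>b > -1\<close> pos by (intro add_nonneg_nonneg divide_nonneg_pos) auto
  qed
qed

text \<open>The series P + 4 x P'. From g'(z) = P(z^2) and g''(z) = 2 z P'(z^2), its value at 1 is
  g'(1) + 2 g''(1).\<close>

definition crit_fps :: "real \<Rightarrow> complex fps" where
  "crit_fps \<nu> = bessel_g'_fps \<nu> + fps_const 4 * (fps_X * fps_deriv (bessel_g'_fps \<nu>))"

lemma fps_nth_crit_fps:
  "fps_nth (crit_fps \<nu>) n = of_real ((-1) ^ n * crit_coeff \<nu> n)"
proof -
  have "fps_nth (crit_fps \<nu>) n = of_nat (4 * n + 1) * fps_nth (bessel_g'_fps \<nu>) n"
    by (cases n) (simp_all add: crit_fps_def algebra_simps)
  also have "\<dots> = of_real ((4 * real n + 1) * ((2 * real n + 1) * bessel_coeff \<nu> n))"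
    by (simp add: fps_nth_bessel_g'_fps)
  also have "(4 * real n + 1) * ((2 * real n + 1) * bessel_coeff \<nu> n) = (-1) ^ n * crit_coeff \<nu> n"
    using power_divide[of "-1::real" 4 n] by (simp add: crit_coeff_def bessel_coeff_def mult_ac)
  finally show ?thesis .
qed

lemma fps_conv_radius_crit_fps [simp]: "\<nu> > -1 \<Longrightarrow> fps_conv_radius (crit_fps \<nu>) = \<infinity>"
  by (simp add: crit_fps_def)

lemma crit_sums:
  assumes "\<nu> > -1"
  shows "(\<lambda>n. (-1) ^ n * crit_coeff \<nu> n) sums crit \<nu>"
    and "of_real (crit \<nu>) = eval_fps (bessel_g'_fps \<nu>) 1 + 4 * eval_fps (fps_deriv (bessel_g'_fps \<nu>)) 1"
    and "summable (crit_coeff \<nu>)"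
proof -
  have "summable (\<lambda>n. norm (fps_nth (crit_fps \<nu>) n * 1 ^ n))"
    using assms by (intro norm_summable_fps) simp
  then show "summable (crit_coeff \<nu>)"
    using crit_coeff_pos[OF assms]
    by (simp add: fps_nth_crit_fps norm_mult norm_power abs_of_pos)
  have "summable (\<lambda>n. fps_nth (crit_fps \<nu>) n * 1 ^ n)"
    using assms by (intro summable_fps) simp
  then have s: "(\<lambda>n. fps_nth (crit_fps \<nu>) n * 1 ^ n) sums eval_fps (crit_fps \<nu>) 1"
    unfolding eval_fps_def by (rule summable_sums)
  then have "summable (\<lambda>n. of_real ((-1) ^ n * crit_coeff \<nu> n) :: complex)"
    by (simp only: fps_nth_crit_fps power_one mult_1_right sums_summable)
  then show r: "(\<lambda>n. (-1) ^ n * crit_coeff \<nu> n) sums crit \<nu>"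
    unfolding crit_def summable_of_real_iff by (rule summable_sums)
  have "of_real (crit \<nu>) = eval_fps (crit_fps \<nu>) 1"
    using sums_of_real[OF r, where 'a = complex] s
    by (simp only: fps_nth_crit_fps power_one mult_1_right) (rule sums_unique2)
  then show "of_real (crit \<nu>) = eval_fps (bessel_g'_fps \<nu>) 1 + 4 * eval_fps (fps_deriv (bessel_g'_fps \<nu>)) 1"
    using assms by (simp add: crit_fps_def eval_fps_add eval_fps_mult)
qed

text \<open>The constant term 1 is left alone and the pairs are (1,2), (3,4), ...: only from index 1
  on are differences of consecutive terms known to be positive and decreasing in the order.\<close>

lemma crit_pairs_sums:
  assumes "\<nu> > -1"
  shows "(\<lambda>m. crit_coeff \<nu> (Suc (2 * m)) - crit_coeff \<nu> (Suc (Suc (2 * m)))) sums (1 - crit \<nu>)"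
proof -
  have "(\<lambda>n. (-1) ^ Suc n * crit_coeff \<nu> (Suc n)) sums (crit \<nu> - 1)"
    using crit_sums(1)[OF assms] sums_Suc_iff[of "\<lambda>n. (-1) ^ n * crit_coeff \<nu> n"] by simp
  from sums_minus[OF sums_group[OF this, of 2]]
  show ?thesis by (simp add: mult.commute atLeastLessThanSuc)
qed

lemma crit_strict_mono:
  assumes "-1 < a" "a < b"
  shows "crit a < crit b"
proof -
  define D where "D = (\<lambda>\<nu> m. crit_coeff \<nu> (Suc (2 * m)) - crit_coeff \<nu> (Suc (Suc (2 * m))))"
  have "(\<lambda>m. D a m - D b m) sums ((1 - crit a) - (1 - crit b))"
    unfolding D_def using assms by (intro sums_diff crit_pairs_sums) auto
  moreover from this have "0 < (\<Sum>m. D a m - D b m)"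
    using crit_coeff_diff_strict_antimono[OF assms]
    by (intro suminf_pos) (auto simp: D_def dest: sums_summable)
  ultimately show ?thesis by (simp add: sums_iff)
qed

section \<open>Enclosure of the root\<close>

lemma crit_le_partial_sum:
  assumes "\<nu> > -1"
  shows "crit \<nu> \<le> 1 - (\<Sum>m<k. crit_coeff \<nu> (Suc (2 * m)) - crit_coeff \<nu> (Suc (Suc (2 * m))))"
proof -
  have "(\<Sum>m<k. crit_coeff \<nu> (Suc (2 * m)) - crit_coeff \<nu> (Suc (Suc (2 * m))))
      \<le> (\<Sum>m. crit_coeff \<nu> (Suc (2 * m)) - crit_coeff \<nu> (Suc (Suc (2 * m))))"
    using crit_pairs_sums[OF assms] crit_coeff_diff_pos[OF assms]
    by (intro sum_le_suminf less_imp_le sums_summable) auto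
  then show ?thesis using sums_unique[OF crit_pairs_sums[OF assms]] by simp
qed

text \<open>Pairing from index 0 bounds from below instead. The pair (0,1) may be negative, so k > 0
  keeps it in the partial sum.\<close>

lemma partial_sum_le_crit:
  assumes "\<nu> > -1" "k > 0"
  shows "(\<Sum>m<k. crit_coeff \<nu> (2 * m) - crit_coeff \<nu> (Suc (2 * m))) \<le> crit \<nu>"
proof -
  have *: "(\<lambda>m. crit_coeff \<nu> (2 * m) - crit_coeff \<nu> (Suc (2 * m))) sums crit \<nu>"
    using sums_group[OF crit_sums(1)[OF assms(1)], of 2]
    by (simp add: mult.commute atLeastLessThanSuc)
  have "0 \<le> crit_coeff \<nu> (2 * m) - crit_coeff \<nu> (Suc (2 * m))" if "m \<in> - {..<k}" for m
    using crit_coeff_diff_pos[OF assms(1), of "2 * m - 1"] that assms(2) by simp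
  then have "(\<Sum>m<k. crit_coeff \<nu> (2 * m) - crit_coeff \<nu> (Suc (2 * m)))
      \<le> (\<Sum>m. crit_coeff \<nu> (2 * m) - crit_coeff \<nu> (Suc (2 * m)))"
    using * by (intro sum_le_suminf) (auto dest: sums_summable)
  then show ?thesis using sums_unique[OF *] by simp
qed

lemma continuous_on_crit: "continuous_on {2..} crit"
proof (rule uniform_limit_theorem)
  show "uniform_limit {2..} (\<lambda>n \<nu>. \<Sum>i<n. (-1) ^ i * crit_coeff \<nu> i) crit sequentially"
    unfolding crit_def
  proof (rule Weierstrass_m_test)
    \<comment> \<open>Every term decreases in the order, so the left end point 2 supplies the
      majorant.\<close>
    show "norm ((-1) ^ n * crit_coeff \<nu> n) \<le> crit_coeff 2 n" if "\<nu> \<in> {2..}" for n \<nu>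
      using that crit_coeff_antimono[of 2 \<nu> n] crit_coeff_pos[of \<nu> n] by (simp add: abs_mult)
    show "summable (crit_coeff 2)" by (rule crit_sums) simp
  qed
  show "\<forall>\<^sub>F n in sequentially. continuous_on {2..} (\<lambda>\<nu>. \<Sum>i<n. (-1) ^ i * crit_coeff \<nu> i)"
    unfolding crit_coeff_def
    by (intro always_eventually allI continuous_intros) (auto simp: pochhammer_eq_0_iff)
qed simp

lemma crit_2_44314_neg: "crit 2.44314 < 0"
proof -
  have "crit 2.44314 \<le> 1 - (\<Sum>m<3. crit_coeff 2.44314 (Suc (2 * m)) - crit_coeff 2.44314 (Suc (Suc (2 * m))))"
    by (rule crit_le_partial_sum) simp
  also have "\<dots> < 0"
    by (simp add: eval_nat_numeral crit_coeff_Suc crit_ratio_def)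
  finally show ?thesis .
qed

lemma crit_2_44315_pos: "crit 2.44315 > 0"
proof -
  have "0 < (\<Sum>m<3. crit_coeff 2.44315 (2 * m) - crit_coeff 2.44315 (Suc (2 * m)))"
    by (simp add: eval_nat_numeral crit_coeff_Suc crit_ratio_def)
  also have "\<dots> \<le> crit 2.44315"
    by (rule partial_sum_le_crit) simp_all
  finally show ?thesis .
qed

subsection \<open>Bessel functions and the criterion\<close>

text \<open>Write a, b, c for Phi, Phi', Phi'' at 1. Then P(1) = a + 2b and P'(1) = 3b + 2c, and
  Bessel's equation removes c, leaving (4 nu - 3)(-2b) - a. Up to the common factor
  \<open>K\<close>, J_nu(1) is a and J_(nu+1)(1) is -2b.\<close>

lemma bessel_equation_lhs:
  assumes "\<nu> > -1"
  shows "of_real (4 * \<nu> - 3) * bessel_J (\<nu> + 1) 1 - bessel_J \<nu> 1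
    = of_real ((1/2) powr \<nu> * rGamma (\<nu> + 1) * crit \<nu>)"
proof -
  let ?\<Phi> = "bessel_fps \<nu>"
  define a b c where "a = eval_fps ?\<Phi> 1" and "b = eval_fps (fps_deriv ?\<Phi>) 1"
    and "c = eval_fps (fps_deriv (fps_deriv ?\<Phi>)) 1"
  define K where "K = (of_real ((1/2) powr \<nu> * rGamma (\<nu> + 1)) :: complex)"
  have "eval_fps (fps_const 4 * (fps_X * fps_deriv (fps_deriv ?\<Phi>))
      + fps_const (of_real (4 * (\<nu> + 1))) * fps_deriv ?\<Phi> + ?\<Phi>) 1 = 0"
    unfolding bessel_fps_ode[OF assms] by simp
  then have ode: "4 * c + of_real (4 * (\<nu> + 1)) * b + a = 0"
    using assms by (simp add: eval_fps_add eval_fps_mult a_def b_def c_def)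
  have "fps_deriv (bessel_g'_fps \<nu>)
      = fps_deriv ?\<Phi> + fps_const 2 * fps_deriv ?\<Phi> + fps_const 2 * (fps_X * fps_deriv (fps_deriv ?\<Phi>))"
    by (simp add: bessel_g'_fps_def algebra_simps)
  then have "of_real (crit \<nu>) = a + 2 * b + 4 * (3 * b + 2 * c)"
    using assms unfolding crit_sums(2)[OF assms] a_def b_def c_def
    by (simp add: eval_fps_add eval_fps_mult eval_fps_bessel_g'_fps)
  also have "\<dots> = of_real (4 * \<nu> - 3) * (- 2 * b) - a"
    using ode by (simp add: algebra_simps) algebra
  finally have crit: "of_real (crit \<nu>) = of_real (4 * \<nu> - 3) * (- 2 * b) - a" .
  have "fps_deriv ?\<Phi> = fps_const (of_real (- 1 / (4 * (\<nu> + 1)))) * bessel_fps (\<nu> + 1)"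
  proof (rule fps_ext)
    fix n
    have "of_real ((real n + 1) * bessel_coeff \<nu> (Suc n))
        = (of_real (- bessel_coeff (\<nu> + 1) n / (4 * (\<nu> + 1))) :: complex)"
      unfolding bessel_coeff_shift[OF assms] ..
    then show "fps_nth (fps_deriv ?\<Phi>) n
        = fps_nth (fps_const (of_real (- 1 / (4 * (\<nu> + 1)))) * bessel_fps (\<nu> + 1)) n"
      by (simp add: add.commute)
  qed
  then have b: "eval_fps (bessel_fps (\<nu> + 1)) 1 = of_real (4 * (\<nu> + 1)) * (- b)"
    using assms by (simp add: b_def eval_fps_mult add_eq_0_iff flip: of_real_add)
  have half: "(1/2 :: complex) powr of_real x = of_real ((1/2) powr x)" for x
    using powr_of_real[of "1/2" x] by simp
  have J0: "bessel_J \<nu> 1 = K * a"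
    unfolding K_def a_def using bessel_J_eq[OF assms, of 1] by (simp add: half)
  have "rGamma (\<nu> + 1) = (\<nu> + 1) * rGamma (\<nu> + 1 + 1)"
    by (rule rGamma_plus1[symmetric])
  then have "K = of_real ((1/2) powr \<nu> * ((\<nu> + 1) * rGamma (\<nu> + 2)))"
    by (simp add: K_def add.assoc)
  moreover have "bessel_J (\<nu> + 1) 1
      = of_real ((1/2) powr (\<nu> + 1) * rGamma (\<nu> + 2)) * (of_real (4 * (\<nu> + 1)) * (- b))"
    using bessel_J_eq[of "\<nu> + 1" 1] assms unfolding b[symmetric] by (simp add: half add.assoc del: of_real_add)
  moreover have "(1/2) powr (\<nu> + 1) = (1/2) powr \<nu> * (1/2 :: real)"
    by (simp add: powr_add)
  ultimately have J1: "bessel_J (\<nu> + 1) 1 = K * (- 2 * b)"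
    by simp
  have "of_real (4 * \<nu> - 3) * bessel_J (\<nu> + 1) 1 - bessel_J \<nu> 1 = K * of_real (crit \<nu>)"
    unfolding J0 J1 crit by (simp add: algebra_simps)
  then show ?thesis by (simp add: K_def)
qed

lemma bessel_g'_at_real:
  assumes "\<nu> > -1"
  shows "eval_fps (bessel_g'_fps \<nu>) (of_real x) \<in> \<real>"
    and "eval_fps (fps_deriv (bessel_g'_fps \<nu>)) (of_real x) \<in> \<real>"
proof -
  have "eval_fps F (of_real x) \<in> \<real>" if "fps_conv_radius F = \<infinity>" "\<And>n. fps_nth F n \<in> \<real>" for F :: "complex fps"
  proof -
    have "summable (\<lambda>n. fps_nth F n * of_real x ^ n)"
      using that by (intro summable_fps) simp
    moreover have "Im (fps_nth F n * of_real x ^ n) = 0" for n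
      using that(2)[of n] by (metis Reals_mult Reals_of_real Reals_power complex_is_Real_iff)
    ultimately have "Im (\<Sum>n. fps_nth F n * of_real x ^ n) = (\<Sum>n. 0)"
      by (simp only: bounded_linear.suminf[OF bounded_linear_Im])
    then show ?thesis by (simp add: eval_fps_def complex_is_Real_iff)
  qed
  then show "eval_fps (bessel_g'_fps \<nu>) (of_real x) \<in> \<real>"
    "eval_fps (fps_deriv (bessel_g'_fps \<nu>)) (of_real x) \<in> \<real>"
    using assms by (auto simp: fps_nth_bessel_g'_fps intro!: Reals_mult)
qed

lemma crit_nonneg_imp_uniformly_convex:
  assumes "\<nu> \<ge> 2" "crit \<nu> \<ge> 0"
  shows "uniformly_convex (bessel_g \<nu>)"
proof -
  let ?P = "eval_fps (bessel_g'_fps \<nu>)" and ?P' = "eval_fps (fps_deriv (bessel_g'_fps \<nu>))"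
  have \<nu>: "\<nu> > -1" using assms by simp
  obtain p where P1: "?P 1 = of_real p"
    using bessel_g'_at_real(1)[OF \<nu>, of 1] by (metis Reals_cases of_real_1)
  obtain p' where P'1: "?P' 1 = of_real p'"
    using bessel_g'_at_real(2)[OF \<nu>, of 1] by (metis Reals_cases of_real_1)
  note p = P1 P'1
  have "norm (of_real (p - 1) :: complex) \<le> 3/5"
    using norm_bessel_g'_minus_1_le[OF assms(1), of 1] p by simp
  then have "p > 0" by (simp only: norm_of_real)
  have "of_real (crit \<nu>) = (of_real (p + 4 * p') :: complex)"
    using crit_sums(2)[OF \<nu>] p by simp
  then have "p + 4 * p' \<ge> 0" using assms(2) by (simp only: of_real_eq_iff)
  \<comment> \<open>Since g''/g' = 2 z P'/P at z^2, the value 1/4 here becomes the required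
    1/2.\<close>
  have bound: "norm (?P' w / ?P w) \<le> 1/4" if "norm w \<le> 1" for w
  proof -
    have "norm (?P' w / ?P w) \<le> - (p' / p)"
      using norm_log_deriv_bessel_g'_le[OF assms(1) that] p by simp
    also have "\<dots> \<le> 1/4" using \<open>p > 0\<close> \<open>p + 4 * p' \<ge> 0\<close> by (simp add: field_simps)
    finally show ?thesis .
  qed
  show ?thesis
  proof (rule uniformly_convex_if_deriv2_le)
    show "bessel_g \<nu> holomorphic_on ball 0 1"
      using has_field_derivative_bessel_g[OF \<nu>] by (auto simp: holomorphic_on_open)
    show "bessel_g \<nu> 0 = 0" by (simp add: bessel_g_eq[OF \<nu>])
    show "deriv (bessel_g \<nu>) 0 = 1"
      by (simp add: deriv_bessel_g[OF \<nu>] eval_fps_at_0 fps_nth_bessel_g'_fps)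
    fix z :: complex assume z: "z \<in> ball 0 1"
    have z2: "norm (z\<^sup>2) \<le> 1" using z by (simp add: norm_power power_le_one)
    show nz: "deriv (bessel_g \<nu>) z \<noteq> 0"
      unfolding deriv_bessel_g[OF \<nu>] using z2 by (intro bessel_g'_nonzero[OF assms(1)]) simp
    have "norm (?P' (z\<^sup>2)) \<le> norm (?P (z\<^sup>2)) / 4"
      using bound[OF z2] nz by (simp add: deriv_bessel_g[OF \<nu>] norm_divide divide_simps)
    then have "2 * norm z * norm (?P' (z\<^sup>2)) \<le> 2 * 1 * (norm (?P (z\<^sup>2)) / 4)"
      using z by (intro mult_mono) auto
    then show "norm (deriv (deriv (bessel_g \<nu>)) z) \<le> norm (deriv (bessel_g \<nu>) z) / 2"
      unfolding deriv_deriv_bessel_g[OF \<nu>] unfolding deriv_bessel_g[OF \<nu>] by (simp add: norm_mult)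
  qed
qed

lemma uniformly_convex_imp_crit_nonneg:
  assumes \<nu>: "\<nu> > -1" and uc: "uniformly_convex (bessel_g \<nu>)"
  shows "crit \<nu> \<ge> 0"
proof -
  define P where "P = (\<lambda>x. Re (eval_fps (bessel_g'_fps \<nu>) (of_real (x\<^sup>2))))"
  define P' where "P' = (\<lambda>x. Re (eval_fps (fps_deriv (bessel_g'_fps \<nu>)) (of_real (x\<^sup>2))))"
  have P: "eval_fps (bessel_g'_fps \<nu>) ((of_real x)\<^sup>2) = of_real (P x)"
    and P': "eval_fps (fps_deriv (bessel_g'_fps \<nu>)) ((of_real x)\<^sup>2) = of_real (P' x)" for x
    using bessel_g'_at_real[OF \<nu>, of "x\<^sup>2"] by (simp_all add: P_def P'_def)
  have cont: "continuous_on UNIV P" "continuous_on UNIV P'"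
    unfolding P_def P'_def using \<nu>
    by (auto intro!: continuous_intros continuous_on_compose2[OF continuous_on_eval_fps])
  have P_pos: "P x > 0" if x: "0 \<le> x" "x < 1" for x
  proof (rule ccontr)
    assume "\<not> P x > 0"
    moreover have "P 0 = 1" by (simp add: P_def eval_fps_at_0 fps_nth_bessel_g'_fps)
    ultimately obtain y where y: "0 \<le> y" "y \<le> x" "P y = 0"
      using IVT2'[of P x 0 0] x cont(1) by (auto intro: continuous_on_subset)
    then have "deriv (bessel_g \<nu>) (of_real y) = 0"
      using P[of y] by (simp add: deriv_bessel_g[OF \<nu>])
    then show False
      using uniformly_convex_deriv_nonzero[OF uc, of "of_real y"] y x by simp
  qed
  \<comment> \<open>The denominator P x is cleared before letting x tend to 1, because P 1 has not
    been shown to be nonzero.\<close>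
  have "0 \<le> P x + 4 * x\<^sup>2 * P' x" if x: "x \<in> {0<..<1}" for x
  proof -
    have "0 \<le> Re (1 + (of_real x - (- of_real x)) *
        (deriv (deriv (bessel_g \<nu>)) (of_real x) / deriv (bessel_g \<nu>) (of_real x)))"
      using x by (intro uniformly_convex_imp_Re_nonneg[OF uc]) auto
    also have "1 + (of_real x - (- of_real x)) *
        (deriv (deriv (bessel_g \<nu>)) (of_real x) / deriv (bessel_g \<nu>) (of_real x))
        = (of_real (1 + 4 * x\<^sup>2 * P' x / P x) :: complex)"
      unfolding deriv_deriv_bessel_g[OF \<nu>] unfolding deriv_bessel_g[OF \<nu>] P P'
      by (simp add: power2_eq_square)
    finally show ?thesis
      using P_pos[of x] x by (simp add: field_simps)
  qed
  moreover have "continuous_on (closure {0<..<1}) (\<lambda>x. P x + 4 * x\<^sup>2 * P' x)"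
    using cont by (intro continuous_intros) (auto intro: continuous_on_subset[OF _ subset_UNIV])
  moreover have "(1::real) \<in> closure {0<..<1}" by simp
  ultimately have "0 \<le> P 1 + 4 * 1\<^sup>2 * P' 1"
    by (rule continuous_ge_on_closure[rotated 2])
  moreover have "of_real (crit \<nu>) = (of_real (P 1 + 4 * P' 1) :: complex)"
    using crit_sums(2)[OF \<nu>] P[of 1] P'[of 1] by simp
  then have "crit \<nu> = P 1 + 4 * P' 1" by (simp only: of_real_eq_iff)
  ultimately show ?thesis by simp
qed

theorem theorem3p5:
  shows "\<exists>\<nu>\<^sub>2::real.
     {\<nu>::real. 0 \<le> \<nu> \<and>
        of_real (4 * \<nu> - 3) * bessel_J (\<nu> + 1) 1 - bessel_J \<nu> 1 = 0} = {\<nu>\<^sub>2} \<and>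
     2.44314 \<le> \<nu>\<^sub>2 \<and> \<nu>\<^sub>2 < 2.44315 \<and>
     (\<forall>\<nu>::real. \<nu> > -1 \<longrightarrow> (uniformly_convex (bessel_g \<nu>) \<longleftrightarrow> \<nu> \<ge> \<nu>\<^sub>2))"
proof -
  obtain \<mu> where \<mu>: "2.44314 \<le> \<mu>" "\<mu> \<le> 2.44315" "crit \<mu> = 0"
    using IVT'[of crit "2.44314" 0 "2.44315"] crit_2_44314_neg crit_2_44315_pos
      continuous_on_subset[OF continuous_on_crit, of "{2.44314..2.44315}"] by auto
  have crit_iff: "0 \<le> crit \<nu> \<longleftrightarrow> \<mu> \<le> \<nu>" "crit \<nu> = 0 \<longleftrightarrow> \<nu> = \<mu>" if "\<nu> > -1" for \<nu>
    using crit_strict_mono[of \<nu> \<mu>] crit_strict_mono[of \<mu> \<nu>] that \<mu>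
    by (cases \<nu> \<mu> rule: linorder_cases; simp)+
  have root_iff: "of_real (4 * \<nu> - 3) * bessel_J (\<nu> + 1) 1 - bessel_J \<nu> 1 = 0 \<longleftrightarrow> \<nu> = \<mu>"
    if "\<nu> \<ge> 0" for \<nu>
  proof -
    have "rGamma (\<nu> + 1) \<noteq> 0"
      using Gamma_real_pos[of "\<nu> + 1"] that by (simp add: rGamma_inverse_Gamma less_imp_neq[symmetric])
    then show ?thesis
      using bessel_equation_lhs[of \<nu>] crit_iff(2)[of \<nu>] that by simp
  qed
  have "\<mu> \<ge> 2" using \<mu>(1) by simp
  then have "uniformly_convex (bessel_g \<nu>) \<longleftrightarrow> \<mu> \<le> \<nu>" if "\<nu> > -1" for \<nu>
    using crit_nonneg_imp_uniformly_convex[of \<nu>] uniformly_convex_imp_crit_nonneg[of \<nu>]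
      crit_iff(1)[OF that] that by fastforce
  moreover have "\<mu> \<noteq> 2.44315" using \<mu>(3) crit_2_44315_pos by (metis less_irrefl)
  ultimately show ?thesis
    using \<mu> root_iff by (intro exI[of _ \<mu>]) auto
qed

end
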